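(* Let $D$ be a positive integer and let $(G_1,G_2,\dots)$ be a sequence of finite graphs with all degrees bounded by $D$ that converges in the local-global sense to a graphing $\mathbf{G}=(J,\mu,E)$. Let $r_{G_n}$ denote the rank function of the cycle matroid of $G_n$. Then \[ \frac{r_{G_n}}{|V(G_n)|} \rightarrowtail \rho_{\mathbf{G}}, \] i.e. the setfunctions $r_{G_n}/|V(G_n)|$ (on all subsets of $E(G_n)$) quotient-converge to $\rho_{\mathbf{G}}$ (on the Borel subsets of $E$).
   Context: A graphing $\mathbf{G}=(J,\mu,E)$ consists of a standard Borel probability space $(J,\mu)$ and a Borel edge set $E\subseteq\binom{J}{2}$ with all degrees bounded, such that $\int_A \deg(B,x)\,d\mu(x)=\int_B\deg(A,x)\,d\mu(x)$ for all measurable $A,B\subseteq J$, where $\deg(S,x)$ is the number of edges from $x$ to $S$. For a Borel $F\subseteq E$, $\mathbf{G}^F=(J,\mu,F)$ and $\mathbf{G}^F_x$ is the connected component of $x$ in $\mathbf{G}^F$. The rank function of the cycle matroid of $\mathbf{G}$ is $\rho_{\mathbf{G}}(F)=1-\int_J \frac{1}{|V(\mathbf{G}^F_x)|}\,d\mu(x)$ for Borel $F\subseteq E$ (with $1/\infty=0$). For a finite graph $G$, $r_G(F)=|V(G)|-(\text{number of connected components of }(V(G),F))$. Local-global convergence: for a finite graph $G$ (with the uniform probability measure on vertices) or a graphing, integers $k,r\ge1$ and a coloring $c:V\to[k]$ (required to be Borel for graphings), $P_r[G,c]$ is the distribution of the isomorphism class (root- and color-preserving) of the colored radius-$r$ ball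 around a random vertex chosen according to the vertex measure; this is a probability vector indexed by the finitely many rooted $[k]$-colored connected graphs of radius at most $r$ and degrees at most $D$. Let $Q_{k,r}(G)=\{P_r[G,c]: c\}$. $G_n$ converges to $\mathbf{G}$ in the local-global sense if $Q_{k,r}(G_n)\to Q_{k,r}(\mathbf{G})$ in Hausdorff distance for all $k,r$. Quotient convergence: for a setfunction $\varphi$ on a set-algebra $(X,\mathcal{B})$, a $k$-quotient is $\varphi\circ F^{-1}$ for a measurable $F:X\to[k]$, viewed as a vector in $\mathbb{R}^{2^k}$ indexed by subsets of $[k]$; $Q_k(\varphi)$ is the set of all $k$-quotients. $\varphi_n\rightarrowtail\varphi$ means $Q_k(\varphi_n)\to Q_k(\varphi)$ in Hausdorff distance in $\mathbb{R}^{2^k}$ for every $k\in\mathbb{N}$. *)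

theory Defs
  imports "HOL-Probability.Probability"
begin

definition adj :: "'v set set \<Rightarrow> 'v \<Rightarrow> 'v \<Rightarrow> bool" where
  "adj E x y \<longleftrightarrow> x \<noteq> y \<and> {x, y} \<in> E"

definition adj_rel :: "'v set set \<Rightarrow> ('v \<times> 'v) set" where
  "adj_rel E = {(x, y). adj E x y}"

definition component :: "'v set set \<Rightarrow> 'v \<Rightarrow> 'v set" where
  "component F x = {y. (x, y) \<in> (adj_rel F)\<^sup>*}"

definition deg_to :: "'v set set \<Rightarrow> 'v set \<Rightarrow> 'v \<Rightarrow> nat" where
  "deg_to E S x = card {y \<in> S. adj E x y}"

definition ball_r :: "'v set set \<Rightarrow> 'v \<Rightarrow> nat \<Rightarrow> 'v set" where
  "ball_r E x r = {y. \<exists>i\<le>r. (x, y) \<in> (adj_rel E) ^^ i}"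

text \<open>A rooted [k]-coloured graph is represented by a triple (n, Eb, col): vertex set
  {0..<n}, edge set Eb, colouring col, root 0. The coloured radius-r ball around x
  (induced subgraph on the ball, coloured by c, rooted at x) is isomorphic to it iff:\<close>
definition ball_iso ::
  "'v set set \<Rightarrow> ('v \<Rightarrow> nat) \<Rightarrow> nat \<Rightarrow> 'v \<Rightarrow> nat \<times> nat set set \<times> (nat \<Rightarrow> nat) \<Rightarrow> bool" where
  "ball_iso E c r x B \<longleftrightarrow> (case B of (n, Eb, col) \<Rightarrow>
     (\<exists>f. bij_betw f {..<n} (ball_r E x r) \<and> f 0 = x \<and>
          (\<forall>i<n. \<forall>j<n. {i, j} \<in> Eb \<longleftrightarrow> adj E (f i) (f j)) \<and>
          (\<forall>i<n. col i = c (f i))))"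

type_synonym rooted_rep = "nat \<times> nat set set \<times> (nat \<Rightarrow> nat)"

definition finite_graph :: "nat \<Rightarrow> nat set \<Rightarrow> nat set set \<Rightarrow> bool" where
  "finite_graph D V E \<longleftrightarrow> finite V \<and> V \<noteq> {} \<and>
     (\<forall>e\<in>E. e \<subseteq> V \<and> card e = 2) \<and> (\<forall>v\<in>V. deg_to E V v \<le> D)"

definition graph_rank :: "nat set \<Rightarrow> nat set set \<Rightarrow> real" where
  "graph_rank V F = real (card V) - real (card (component F ` V))"

definition P_fin :: "nat set \<Rightarrow> nat set set \<Rightarrow> nat \<Rightarrow> (nat \<Rightarrow> nat) \<Rightarrow> rooted_rep \<Rightarrow> real" where
  "P_fin V E r c B = real (card {x \<in> V. ball_iso E c r x B}) / real (card V)"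

definition Q_fin :: "nat set \<Rightarrow> nat set set \<Rightarrow> nat \<Rightarrow> nat \<Rightarrow> (rooted_rep \<Rightarrow> real) set" where
  "Q_fin V E k r = {P_fin V E r c | c. \<forall>v\<in>V. c v < k}"

text \<open>Borel sets of edges: subsets of binom(J,2), identified with symmetric subsets of J x J.\<close>
definition borel_edges :: "'a measure \<Rightarrow> 'a set set \<Rightarrow> bool" where
  "borel_edges M F \<longleftrightarrow> (\<forall>e\<in>F. \<exists>x y. x \<noteq> y \<and> e = {x, y}) \<and>
     {(x, y). {x, y} \<in> F \<and> x \<noteq> y} \<in> sets (M \<Otimes>\<^sub>M M)"

definition graphing :: "('a::polish_space) measure \<Rightarrow> 'a set set \<Rightarrow> bool" where
  "graphing M E \<longleftrightarrow> prob_space M \<and> sets M = sets borel \<and> borel_edges M E \<and>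
     (\<exists>B::nat. \<forall>x. deg_to E UNIV x \<le> B \<and> finite {y. adj E x y}) \<and>
     (\<forall>A\<in>sets M. \<forall>B\<in>sets M.
        (\<integral>\<^sup>+x\<in>A. ennreal (real (deg_to E B x)) \<partial>M) =
        (\<integral>\<^sup>+x\<in>B. ennreal (real (deg_to E A x)) \<partial>M))"

text \<open>rho_G(F) = 1 - int 1/|V(G^F_x)| d mu(x), with 1/infinity = 0
  (in Isabelle card of an infinite set is 0 and 1/0 = 0).\<close>
definition graphing_rank :: "'a measure \<Rightarrow> 'a set set \<Rightarrow> real" where
  "graphing_rank M F = 1 - (\<integral>x. 1 / real (card (component F x)) \<partial>M)"

definition P_gr :: "'a measure \<Rightarrow> 'a set set \<Rightarrow> nat \<Rightarrow> ('a \<Rightarrow> nat) \<Rightarrow> rooted_rep \<Rightarrow> real" where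
  "P_gr M E r c B = measure M {x \<in> space M. ball_iso E c r x B}"

definition Q_gr :: "'a measure \<Rightarrow> 'a set set \<Rightarrow> nat \<Rightarrow> nat \<Rightarrow> (rooted_rep \<Rightarrow> real) set" where
  "Q_gr M E k r = {P_gr M E r c | c. c \<in> M \<rightarrow>\<^sub>M count_space UNIV \<and> (\<forall>x\<in>space M. c x < k)}"

definition hausdorff_conv :: "('b \<Rightarrow> 'b \<Rightarrow> real) \<Rightarrow> (nat \<Rightarrow> 'b set) \<Rightarrow> 'b set \<Rightarrow> bool" where
  "hausdorff_conv d Qs Q \<longleftrightarrow> (\<forall>\<epsilon>>0. \<forall>\<^sub>F n in sequentially.
      (\<forall>p\<in>Qs n. \<exists>q\<in>Q. d p q < \<epsilon>) \<and> (\<forall>q\<in>Q. \<exists>p\<in>Qs n. d p q < \<epsilon>))"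

text \<open>Sup-distance of the (finitely supported up to isomorphism) ball distributions.\<close>
definition dist_P :: "(rooted_rep \<Rightarrow> real) \<Rightarrow> (rooted_rep \<Rightarrow> real) \<Rightarrow> real" where
  "dist_P p q = (SUP B. \<bar>p B - q B\<bar>)"

definition local_global_conv ::
  "(nat \<Rightarrow> nat set) \<Rightarrow> (nat \<Rightarrow> nat set set) \<Rightarrow> 'a measure \<Rightarrow> 'a set set \<Rightarrow> bool" where
  "local_global_conv Vs Es M E \<longleftrightarrow> (\<forall>k\<ge>1. \<forall>r\<ge>1.
      hausdorff_conv dist_P (\<lambda>n. Q_fin (Vs n) (Es n) k r) (Q_gr M E k r))"

text \<open>k-quotients, as vectors indexed by subsets of [k] = {0..<k}.\<close>
definition quotients_fin :: "nat set set \<Rightarrow> (nat set set \<Rightarrow> real) \<Rightarrow> nat \<Rightarrow> (nat set \<Rightarrow> real) set" where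
  "quotients_fin X \<phi> k = {(\<lambda>S. \<phi> {e \<in> X. F e \<in> S}) | F. \<forall>e\<in>X. F e < k}"

definition quotients_gr ::
  "'a measure \<Rightarrow> 'a set set \<Rightarrow> ('a set set \<Rightarrow> real) \<Rightarrow> nat \<Rightarrow> (nat set \<Rightarrow> real) set" where
  "quotients_gr M X \<phi> k = {(\<lambda>S. \<phi> {e \<in> X. F e \<in> S}) | F.
      (\<forall>e\<in>X. F e < k) \<and> (\<forall>i<k. borel_edges M {e \<in> X. F e = i})}"

definition dist_quot :: "nat \<Rightarrow> (nat set \<Rightarrow> real) \<Rightarrow> (nat set \<Rightarrow> real) \<Rightarrow> real" where
  "dist_quot k p q = Max ((\<lambda>S. \<bar>p S - q S\<bar>) ` Pow {..<k})"

end

theory Submission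
  imports Defs
begin

text \<open>
  A finite graph with the uniform measure on its vertices is itself a Borel graph on a probability
  space, and its normalised rank is \<open>1 - E[1 / |component|]\<close>, so one estimate, applied in both
  directions, suffices. Up to an error \<open>1/r\<close> the expectation depends only on the distribution of
  coloured \<open>r\<close>-balls, provided that the edge labelling can be read off from a vertex colouring with
  boundedly many colours. Such a colouring is obtained from a colouring in which any two vertices at
  distance at most 2 differ: record at each vertex its own colour together with the labels of its
  edges, indexed by the colours of the neighbours. Conversely, every vertex colouring decodes to an
  edge labelling.

  Measurability of ball types and the existence of a Borel distance-2 colouring with finitely many
  colours rest on a special case of the Lusin-Novikov theorem: a Borel relation with sections of
  bounded size is a countable union of graphs of Borel partial functions. It is deduced from the
  Lusin separation theorem.
\<close>

text \<open>Two mismatches shape the proof. Rank is global, while the hypothesis sees bounded balls;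
  this is bridged because a component that an r-ball cannot exhaust adds at most 1/r to the mean at
  each vertex. And the hypothesis speaks of vertex colourings, the conclusion of edge labellings.
  Distance 2 makes the encoding unambiguous: two neighbours of one vertex are at distance at most 2,
  so a neighbour's colour names a single edge. The number of colours has to be fixed before n
  varies: a countable colouring comes from a countable basis, and greedy recolouring along it brings
  the number down to the size of a 2-ball.

  The remaining obstacle is measurability. That the ball around x has a given type is a statement
  quantifying over uncountably many vertices, hence not visibly Borel. Once countably many Borel
  maps enumerate the neighbours of every vertex, finite words name the vertices of a ball and these
  quantifiers become countable; this is what Lusin-Novikov is for.\<close>

section \<open>Borel relations with sections of bounded size\<close>

definition closed_projection :: "'a::topological_space set \<Rightarrow> bool" where
  "closed_projection A \<longleftrightarrow> (\<exists>C :: ('a \<times> (nat \<Rightarrow> nat discrete)) set. closed C \<and> A = fst ` C)"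

lemma continuous_on_coordinate_of_pair:
  "continuous_on UNIV (\<lambda>p :: ('b \<Rightarrow> 'c::topological_space) \<times> 'a::topological_space. fst p i)"
  "continuous_on UNIV (\<lambda>p :: 'a::topological_space \<times> ('b \<Rightarrow> 'c::topological_space). snd p i)"
  by (rule continuous_on_product_then_coordinatewise, intro continuous_intros)+

lemma borel_vimage:
  assumes "continuous_on UNIV f" "A \<in> sets borel"
  shows "f -` A \<in> sets borel"
  using measurable_sets[OF borel_measurable_continuous_onI[OF assms(1)] assms(2)] by simp

lemma closed_projection_closed:
  assumes "closed A"
  shows "closed_projection A"
  unfolding closed_projection_def
  by (rule exI[of _ "A \<times> UNIV"]) (auto intro: closed_Times assms)

text \<open>Entry 0 of the Baire sequence names a set containing the point; the shifted tail
  witnesses membership in it.\<close>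

lemma closed_projection_UN:
  fixes A :: "nat \<Rightarrow> 'a::topological_space set"
  assumes "\<And>n. closed_projection (A n)"
  shows "closed_projection (\<Union>n. A n)"
proof -
  obtain C :: "nat \<Rightarrow> ('a \<times> (nat \<Rightarrow> nat discrete)) set"
    where C: "\<And>n. closed (C n)" "\<And>n. A n = fst ` C n"
    using assms unfolding closed_projection_def by metis
  define C' where "C' = {p. (fst p, \<lambda>i. snd p (Suc i)) \<in> C (of_discrete (snd p 0))}"
  have eq: "C' = (\<Inter>n. (\<lambda>p. snd p 0) -` (- {discrete n})
                 \<union> (\<lambda>p. (fst p, \<lambda>i. snd p (Suc i))) -` C n)"
    by (auto simp: C'_def discrete_inverse) (metis of_discrete_inverse)
  have "closed C'"
    unfolding eq
    by (intro closed_INT closed_Un ballI closed_vimage C continuous_on_Pair continuous_on_fst continuous_on_id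
          continuous_on_coordinatewise_then_product continuous_on_coordinate_of_pair)
       (auto simp: closed_def open_discrete)
  moreover have "(\<Union>n. A n) = fst ` C'"
  proof safe
    fix x n assume "x \<in> A n"
    then obtain s where "(x, s) \<in> C n" using C by auto
    then have "(x, \<lambda>i. case i of 0 \<Rightarrow> discrete n | Suc j \<Rightarrow> s j) \<in> C'"
      by (simp add: C'_def discrete_inverse)
    then show "x \<in> fst ` C'" by force
  next
    fix x s assume "(x, s) \<in> C'"
    then show "fst (x, s) \<in> (\<Union>n. A n)"
      using C by (force simp: C'_def)
  qed
  ultimately show ?thesis unfolding closed_projection_def by blast
qed

text \<open>One sequence interleaves the witnesses for all n, the n-th one at the positions
  \<open>prod_encode (n, i)\<close>.\<close>

lemma closed_projection_INT:
  fixes A :: "nat \<Rightarrow> 'a::topological_space set"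
  assumes "\<And>n. closed_projection (A n)"
  shows "closed_projection (\<Inter>n. A n)"
proof -
  obtain C :: "nat \<Rightarrow> ('a \<times> (nat \<Rightarrow> nat discrete)) set"
    where C: "\<And>n. closed (C n)" "\<And>n. A n = fst ` C n"
    using assms unfolding closed_projection_def by metis
  define C' where "C' = (\<Inter>n. (\<lambda>p. (fst p, \<lambda>i. snd p (prod_encode (n, i)))) -` C n)"
  have "closed C'"
    unfolding C'_def
    by (intro closed_INT ballI closed_vimage C continuous_on_Pair continuous_on_fst continuous_on_id
          continuous_on_coordinatewise_then_product continuous_on_coordinate_of_pair)
  moreover have "(\<Inter>n. A n) = fst ` C'"
  proof safe
    fix x assume "x \<in> (\<Inter>n. A n)"
    then have "\<forall>n. \<exists>s. (x, s) \<in> C n" using C by force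
    then obtain s where s: "\<And>n. (x, s n) \<in> C n" by metis
    then have "(x, \<lambda>i. s (fst (prod_decode i)) (snd (prod_decode i))) \<in> C'"
      by (simp add: C'_def)
    then show "x \<in> fst ` C'" by force
  next
    fix x s n assume "(x, s) \<in> C'"
    then have "(x, \<lambda>i. s (prod_encode (n, i))) \<in> C n" by (simp add: C'_def)
    then show "fst (x, s) \<in> A n"
      using C by force
  qed
  ultimately show ?thesis unfolding closed_projection_def by blast
qed

text \<open>An open set is the union over n of the closed sets of points at distance at least 1 / (n
  + 1) from its complement. The whole space is treated apart, because \<open>infdist\<close> to the
  empty set is 0.\<close>

lemma closed_projection_open:
  fixes U :: "'a::metric_space set"
  assumes "open U"
  shows "closed_projection U"
proof (cases "U = UNIV")
  case True
  then show ?thesis by (auto intro: closed_projection_closed)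
next
  case False
  then have ne: "- U \<noteq> {}" by auto
  have "U = (\<Union>n. {x. 1 / real (Suc n) \<le> infdist x (- U)})"
  proof safe
    fix x assume "x \<in> U"
    then have "infdist x (- U) > 0"
      using in_closed_iff_infdist_zero[of "- U" x] assms ne infdist_nonneg[of x "- U"]
      by (auto simp: order_less_le)
    then show "x \<in> (\<Union>n. {x. 1 / real (Suc n) \<le> infdist x (- U)})"
      by (metis (mono_tags, lifting) UN_iff UNIV_I inverse_eq_divide less_imp_le
          mem_Collect_eq reals_Archimedean)
  next
    fix x n assume "1 / real (Suc n) \<le> infdist x (- U)"
    moreover have "0 < 1 / real (Suc n)" by simp
    ultimately have "infdist x (- U) \<noteq> 0" by linarith
    then show "x \<in> U" by (metis ComplI infdist_zero)
  qed
  moreover have "closed {x. 1 / real (Suc n) \<le> infdist x (- U)}" for n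
    by (intro closed_Collect_le continuous_intros)
  ultimately show ?thesis
    by (metis (no_types, lifting) closed_projection_UN closed_projection_closed)
qed

lemma closed_projection_borel:
  fixes A :: "'a::metric_space set"
  assumes "A \<in> sets borel"
  shows "closed_projection A"
proof -
  have "A \<in> sigma_sets UNIV {S::'a set. open S}" using assms by (simp add: borel_def)
  \<comment> \<open>Carrying the complement along makes the complement case trivial; projections of
    closed sets are not stable under complement by themselves.\<close>
  then have "closed_projection A \<and> closed_projection (- A)"
  proof induction
    case (Basic a)
    then show ?case by (auto intro: closed_projection_open closed_projection_closed)
  next
    case (Compl a)
    then show ?case by (simp add: Compl_eq_Diff_UNIV[symmetric])
  next
    case (Union a)
    then show ?case by (simp add: closed_projection_UN closed_projection_INT)
  qed (auto intro: closed_projection_closed)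
  then show ?thesis ..
qed

section \<open>Lusin's separation theorem\<close>

definition borel_separable :: "'a::topological_space set \<Rightarrow> 'a set \<Rightarrow> bool" where
  "borel_separable P Q \<longleftrightarrow> (\<exists>S\<in>sets borel. P \<subseteq> S \<and> Q \<inter> S = {})"

text \<open>Applied in contraposition: if two countable unions are inseparable, some pair of pieces
  already is.\<close>

lemma borel_separable_UN:
  fixes P Q :: "nat \<Rightarrow> 'a::topological_space set"
  assumes "\<And>m n. borel_separable (P m) (Q n)"
  shows "borel_separable (\<Union>m. P m) (\<Union>n. Q n)"
proof -
  obtain S where S: "\<And>m n. S m n \<in> sets borel" "\<And>m n. P m \<subseteq> S m n" "\<And>m n. Q n \<inter> S m n = {}"
    using assms unfolding borel_separable_def by metis
  show ?thesis
    unfolding borel_separable_def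
  proof (intro bexI conjI)
    show "(\<Union>m. \<Inter>n. S m n) \<in> sets borel"
      by (intro sets.countable_UN'' sets.countable_INT'' S(1)) auto
    show "(\<Union>m. P m) \<subseteq> (\<Union>m. \<Inter>n. S m n)" using S(2) by blast
    show "(\<Union>n. Q n) \<inter> (\<Union>m. \<Inter>n. S m n) = {}" using S(3) by blast
  qed
qed

lemma dense_sequence_exists:
  "\<exists>d :: nat \<Rightarrow> 'a::{metric_space, second_countable_topology}. \<forall>x. \<forall>e>0. \<exists>n. dist (d n) x < e"
proof -
  obtain D :: "'a set" where D: "countable D" "\<And>X. open X \<Longrightarrow> X \<noteq> {} \<Longrightarrow> \<exists>d\<in>D. d \<in> X"
    by (rule countable_dense_setE) blast
  have "\<exists>n. dist (from_nat_into D n) x < e" if "e > 0" for x e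
  proof -
    have "ball x e \<noteq> {}" using that by auto
    then obtain y where "y \<in> D" "y \<in> ball x e" using D(2)[of "ball x e"] by auto
    then show ?thesis using from_nat_into_surj[OF D(1)] by (metis dist_commute mem_ball)
  qed
  then show ?thesis by blast
qed

lemma open_basis_sequence_exists:
  "\<exists>U :: nat \<Rightarrow> 'a::second_countable_topology set.
     (\<forall>i. open (U i)) \<and> (\<forall>W x. open W \<longrightarrow> x \<in> W \<longrightarrow> (\<exists>i. x \<in> U i \<and> U i \<subseteq> W))"
proof -
  obtain \<B> :: "'a set set" where \<B>: "countable \<B>" "topological_basis \<B>"
    using ex_countable_basis by blast
  have "\<B> \<noteq> {}"
    using topological_basisE[OF \<B>(2) open_UNIV] by (metis UNIV_I empty_iff)
  then have "open (from_nat_into \<B> i)" for i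
    using topological_basis_open[OF \<B>(2)] by (simp add: from_nat_into)
  moreover have "\<exists>i. x \<in> from_nat_into \<B> i \<and> from_nat_into \<B> i \<subseteq> W" if "open W" "x \<in> W" for x W
    by (metis \<B> from_nat_into_surj that topological_basisE)
  ultimately show ?thesis by blast
qed

text \<open>Cut both sets into countably many closed pieces of small radius: some pair of pieces
  still has inseparable images. Iterating yields nested pieces shrinking to points \<open>a\<close>
  and \<open>b\<close>; by continuity the late images lie in disjoint neighbourhoods of
  \<open>f a\<close> and \<open>g b\<close>, which do separate them.\<close>

lemma borel_separable_closed_images:
  fixes f g :: "'b::{complete_space, second_countable_topology} \<Rightarrow> 'a::t2_space"
  assumes f: "continuous_on UNIV f" and g: "continuous_on UNIV g"
    and "closed A" "closed B" and disj: "f ` A \<inter> g ` B = {}"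
  shows "borel_separable (f ` A) (g ` B)"
proof (rule ccontr)
  assume nsep: "\<not> borel_separable (f ` A) (g ` B)"
  obtain d :: "nat \<Rightarrow> 'b" where d: "\<And>x e. e > 0 \<Longrightarrow> \<exists>n. dist (d n) x < e"
    using dense_sequence_exists by blast
  define small where "small n X \<longleftrightarrow> (\<exists>a::'b. X \<subseteq> cball a (1 / real n))" for n X
  \<comment> \<open>The size condition starts at n = 1: stage 0 is the given pair, and since 1 / 0 =
    0, \<open>small 0\<close> would allow at most one point.\<close>
  define Good where "Good n p \<longleftrightarrow> closed (fst p) \<and> closed (snd p) \<and> fst p \<subseteq> A \<and> snd p \<subseteq> B
      \<and> \<not> borel_separable (f ` fst p) (g ` snd p)
      \<and> (0 < n \<longrightarrow> small n (fst p) \<and> small n (snd p))" for n p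
  have cover: "X = (\<Union>m. X \<inter> cball (d m) (1 / real (Suc n)))" for X n
  proof -
    have "\<exists>m. x \<in> cball (d m) (1 / real (Suc n))" for x
      using d[of "1 / real (Suc n)" x] by (auto intro: less_imp_le)
    then show ?thesis by blast
  qed
  have "\<exists>S. \<forall>n. Good n (S n) \<and> fst (S (Suc n)) \<subseteq> fst (S n) \<and> snd (S (Suc n)) \<subseteq> snd (S n)"
  proof (rule dependent_nat_choice)
    show "\<exists>p. Good 0 p"
      using assms nsep by (intro exI[of _ "(A, B)"]) (auto simp: Good_def)
  next
    fix p n assume p: "Good n p"
    define X where "X m = fst p \<inter> cball (d m) (1 / real (Suc n))" for m
    define Y where "Y m = snd p \<inter> cball (d m) (1 / real (Suc n))" for m
    have "fst p = (\<Union>m. X m)" "snd p = (\<Union>m. Y m)" unfolding X_def Y_def by (rule cover)+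
    then have eq: "f ` fst p = (\<Union>m. f ` X m)" "g ` snd p = (\<Union>m. g ` Y m)" by auto
    have "\<not> borel_separable (\<Union>m. f ` X m) (\<Union>m. g ` Y m)"
      using p unfolding eq[symmetric] Good_def by blast
    then obtain m m' where m: "\<not> borel_separable (f ` X m) (g ` Y m')"
      using borel_separable_UN by metis
    have "Good (Suc n) (X m, Y m')"
      using p m by (auto simp: Good_def X_def Y_def small_def intro!: closed_Int)
    then show "\<exists>q. Good (Suc n) q \<and> fst q \<subseteq> fst p \<and> snd q \<subseteq> snd p"
      by (intro exI[of _ "(X m, Y m')"]) (auto simp: X_def Y_def)
  qed
  then obtain S where S: "\<And>n. Good n (S n)"
    and dec1: "\<And>n. fst (S (Suc n)) \<subseteq> fst (S n)" and dec2: "\<And>n. snd (S (Suc n)) \<subseteq> snd (S n)"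
    by blast
  \<comment> \<open>An empty set is separable from anything, by the empty set or by the whole
    space.\<close>
  have ne: "fst (S n) \<noteq> {}" "snd (S n) \<noteq> {}" for n
    using S[of n] unfolding Good_def borel_separable_def
    by (metis empty_subsetI image_empty inf_bot_right sets.empty_sets,
        metis S UNIV_I image_empty inf_bot_left sets.top space_borel subset_UNIV)
  have diam: "\<exists>n. \<forall>x\<in>X n. \<forall>y\<in>X n. dist x y < e"
    if sm: "\<And>n. small (Suc n) (X (Suc n))" and "e > 0" for e X
  proof -
    obtain n where n: "1 / real (Suc n) < e / 2"
      using reals_Archimedean[of "e / 2"] \<open>e > 0\<close> by (auto simp: inverse_eq_divide)
    obtain a where a: "X (Suc n) \<subseteq> cball a (1 / real (Suc n))"
      using sm unfolding small_def by blast
    have "dist x y < e" if "x \<in> X (Suc n)" "y \<in> X (Suc n)" for x y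
    proof -
      have "dist a x < e / 2" "dist a y < e / 2" using a that n by force+
      then show ?thesis using dist_triangle_half_r by blast
    qed
    then show ?thesis by blast
  qed
  have sm: "small (Suc n) (fst (S (Suc n)))" "small (Suc n) (snd (S (Suc n)))" for n
    using S[of "Suc n"] by (auto simp: Good_def)
  obtain a where a: "\<And>n. a \<in> fst (S n)"
    by (rule decreasing_closed_nest[of "\<lambda>n. fst (S n)"])
       (use S ne dec1 lift_Suc_antimono_le[of "\<lambda>n. fst (S n)"] diam[of "\<lambda>n. fst (S n)"] sm
         in \<open>auto simp: Good_def\<close>)
  obtain b where b: "\<And>n. b \<in> snd (S n)"
    by (rule decreasing_closed_nest[of "\<lambda>n. snd (S n)"])
       (use S ne dec2 lift_Suc_antimono_le[of "\<lambda>n. snd (S n)"] diam[of "\<lambda>n. snd (S n)"] sm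
         in \<open>auto simp: Good_def\<close>)
  have "a \<in> A" "b \<in> B" using a[of 0] b[of 0] S[of 0] by (auto simp: Good_def)
  then have "f a \<noteq> g b" using disj by auto
  then obtain U V where UV: "open U" "open V" "f a \<in> U" "g b \<in> V" "U \<inter> V = {}"
    by (metis hausdorff)
  have inside: "\<exists>N. \<forall>n\<ge>N. h ` X n \<subseteq> W"
    if h: "continuous_on UNIV h" and W: "open W" "h c \<in> W" and c: "\<And>n. c \<in> X n"
      and sm: "\<And>n. small (Suc n) (X (Suc n))" and dec: "\<And>n. X (Suc n) \<subseteq> X n"
    for h :: "'b \<Rightarrow> 'a" and W c X
  proof -
    have "open (h -` W)" using h W by (simp add: open_vimage)
    then obtain e where e: "e > 0" "ball c e \<subseteq> h -` W"
      using W(2) open_contains_ball by (metis vimageI)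
    obtain n where n: "\<forall>x\<in>X n. \<forall>y\<in>X n. dist x y < e"
      using diam[of X e] sm e(1) by blast
    have "h ` X m \<subseteq> W" if "m \<ge> n" for m
    proof -
      have "X m \<subseteq> X n" using lift_Suc_antimono_le[of X n m] dec that by blast
      then have "X m \<subseteq> ball c e" using n c by (auto simp: subset_iff)
      then show ?thesis using e(2) by auto
    qed
    then show ?thesis by blast
  qed
  obtain N1 where N1: "\<And>n. n \<ge> N1 \<Longrightarrow> f ` fst (S n) \<subseteq> U"
    using inside[OF f UV(1,3), of "\<lambda>n. fst (S n)"] a sm dec1 by blast
  obtain N2 where N2: "\<And>n. n \<ge> N2 \<Longrightarrow> g ` snd (S n) \<subseteq> V"
    using inside[OF g UV(2,4), of "\<lambda>n. snd (S n)"] b sm dec2 by blast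
  define n where "n = max N1 N2"
  have "f ` fst (S n) \<subseteq> U" "g ` snd (S n) \<inter> U = {}"
    using N1[of n] N2[of n] UV(5) by (auto simp: n_def)
  then have "borel_separable (f ` fst (S n)) (g ` snd (S n))"
    unfolding borel_separable_def using UV(1) by (intro bexI[of _ U]) auto
  then show False using S[of n] by (simp add: Good_def)
qed

text \<open>A Borel set is itself a projection of a closed set, so both images are continuous images
  of closed sets.\<close>

lemma borel_separable_fst_images:
  fixes A B :: "('w::{complete_space, second_countable_topology}
                  \<times> 'y::{complete_space, second_countable_topology}) set"
  assumes "A \<in> sets borel" "B \<in> sets borel" "fst ` A \<inter> fst ` B = {}"
  shows "borel_separable (fst ` A) (fst ` B)"
proof -
  obtain C C' :: "(('w \<times> 'y) \<times> (nat \<Rightarrow> nat discrete)) set"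
    where C: "closed C" "A = fst ` C" and C': "closed C'" "B = fst ` C'"
    using assms(1,2)[THEN closed_projection_borel] unfolding closed_projection_def by blast
  have "borel_separable ((\<lambda>p. fst (fst p)) ` C) ((\<lambda>p. fst (fst p)) ` C')"
    by (intro borel_separable_closed_images C C' continuous_intros)
       (use assms(3) C C' in auto)
  then show ?thesis using C C' by (simp add: image_image)
qed

text \<open>Separation turns the question whether the value at \<open>w\<close> lies in a given
  small ball into a Borel test on \<open>w\<close> alone. The value is then the limit of the first
  dense points whose balls pass the test, as the radius shrinks.\<close>

lemma borel_selector_of_functional_relation:
  fixes R :: "('w::{complete_space, second_countable_topology}
                \<times> 'y::{complete_space, second_countable_topology}) set"
  assumes R: "R \<in> sets borel" and fn: "\<And>w y y'. (w, y) \<in> R \<Longrightarrow> (w, y') \<in> R \<Longrightarrow> y = y'"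
  shows "\<exists>g. g \<in> borel_measurable borel \<and> (\<forall>w y. (w, y) \<in> R \<longrightarrow> g w = y)"
proof -
  obtain d :: "nat \<Rightarrow> 'y" where d: "\<And>x e. e > 0 \<Longrightarrow> \<exists>n. dist (d n) x < e"
    using dense_sequence_exists by blast
  define U where "U n m = ball (d n) (1 / real (Suc m))" for n m
  have "\<exists>S\<in>sets borel. \<forall>w y. (w, y) \<in> R \<longrightarrow> (w \<in> S \<longleftrightarrow> y \<in> U n m)" for n m
  proof -
    have *: "(UNIV \<times> U n m) \<in> sets (borel :: ('w \<times> 'y) measure)"
      by (intro borel_open open_Times) (auto simp: U_def)
    have **: "(UNIV \<times> - U n m) \<in> sets (borel :: ('w \<times> 'y) measure)"
      by (intro borel_closed closed_Times) (auto simp: U_def)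
    have "borel_separable (fst ` (R \<inter> UNIV \<times> U n m)) (fst ` (R \<inter> UNIV \<times> - U n m))"
      by (intro borel_separable_fst_images sets.Int R * **) (use fn in fastforce)
    then obtain S where S: "S \<in> sets borel" "fst ` (R \<inter> UNIV \<times> U n m) \<subseteq> S"
        "fst ` (R \<inter> UNIV \<times> - U n m) \<inter> S = {}"
      unfolding borel_separable_def by blast
    show ?thesis using S by (intro bexI[of _ S]) force+
  qed
  then obtain S where S: "\<And>n m. S n m \<in> sets borel"
      "\<And>n m w y. (w, y) \<in> R \<Longrightarrow> w \<in> S n m \<longleftrightarrow> y \<in> U n m"
    by metis
  define f where "f m w = d (LEAST n. w \<in> S n m)" for m w
  have f_meas[measurable]: "f m \<in> borel_measurable borel" for m
  proof -
    have [measurable]: "S n m \<in> sets borel" for n by (rule S)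
    have "(\<lambda>w. LEAST n. w \<in> S n m) \<in> borel \<rightarrow>\<^sub>M count_space UNIV" by measurable
    then show ?thesis unfolding f_def by (rule measurable_compose) simp
  qed
  have f_lim: "(\<lambda>m. f m w) \<longlonglongrightarrow> y" if wy: "(w, y) \<in> R" for w y
  proof (rule metric_LIMSEQ_I)
    fix e :: real assume "e > 0"
    obtain N where N: "1 / real (Suc N) < e"
      using reals_Archimedean[OF \<open>e > 0\<close>] by (auto simp: inverse_eq_divide)
    have "dist (f m w) y < e" if "m \<ge> N" for m
    proof -
      obtain n where "dist (d n) y < 1 / real (Suc m)" using d[of "1 / real (Suc m)" y] by auto
      then have "w \<in> S n m" using S(2)[OF wy] by (simp add: U_def)
      then have "w \<in> S (LEAST n. w \<in> S n m) m" by (rule LeastI)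
      then have "dist (f m w) y < 1 / real (Suc m)"
        using S(2)[OF wy] by (simp add: U_def f_def)
      also have "\<dots> \<le> 1 / real (Suc N)" using that by (simp add: frac_le)
      finally show ?thesis using N by simp
    qed
    then show "\<exists>N. \<forall>m\<ge>N. dist (f m w) y < e" by blast
  qed
  \<comment> \<open>Off the domain of \<open>R\<close>, which is not known to be Borel at this
    point, the centres may fail to converge. Being Cauchy is a Borel condition on \<open>w\<close>,
    and where it fails a constant sequence is used.\<close>
  define f' where "f' m w = (if Cauchy (\<lambda>m. f m w) then f m w else d 0)" for m w
  define g where "g w = lim (\<lambda>m. f' m w)" for w
  have "g \<in> borel_measurable borel"
  proof (rule borel_measurable_LIMSEQ_metric)
    show "f' m \<in> borel_measurable borel" for m unfolding f'_def by measurable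
    fix w
    have "convergent (\<lambda>m. f' m w)"
      by (cases "Cauchy (\<lambda>m. f m w)") (auto simp: f'_def Cauchy_convergent_iff convergent_const)
    then show "(\<lambda>m. f' m w) \<longlonglongrightarrow> g w" unfolding g_def by (rule convergent_LIMSEQ_iff[THEN iffD1])
  qed
  moreover have "g w = y" if "(w, y) \<in> R" for w y
  proof -
    have "Cauchy (\<lambda>m. f m w)" using f_lim[OF that] by (metis LIMSEQ_imp_Cauchy)
    then show ?thesis using f_lim[OF that] unfolding g_def f'_def by (simp add: limI)
  qed
  ultimately show ?thesis by blast
qed

text \<open>The induction adds a coordinate to the base space at every step; taking sequences as base
  space keeps the type fixed.\<close>

lemma bounded_sections_selectors_aux:
  fixes R :: "((nat \<Rightarrow> 'a::polish_space) \<times> 'a) set"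
  assumes "R \<in> sets borel" "\<And>w. finite {y. (w, y) \<in> R}" "\<And>w. card {y. (w, y) \<in> R} \<le> m"
  shows "\<exists>D g. (\<forall>i::nat. D i \<in> sets borel \<and> g i \<in> borel_measurable borel)
           \<and> (\<forall>w y. (w, y) \<in> R \<longleftrightarrow> (\<exists>i. w \<in> D i \<and> y = g i w))"
  using assms
proof (induction m arbitrary: R)
  case 0
  then have "{y. (w, y) \<in> R} = {}" for w by (metis card_0_eq le_zero_eq)
  then show ?case
    by (intro exI[of _ "\<lambda>_. {}"] exI[of _ "\<lambda>_ _. undefined"]) auto
next
  case (Suc m)
  obtain U :: "nat \<Rightarrow> 'a set" where U_open: "\<And>i. open (U i)"
    and U_basis: "\<And>W x. open W \<Longrightarrow> x \<in> W \<Longrightarrow> \<exists>i. x \<in> U i \<and> U i \<subseteq> W"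
    using open_basis_sequence_exists by blast
  \<comment> \<open>The head of the sequence is a point of the section over the tail, and the
    section of \<open>T i\<close> lists the other points of that section in \<open>U i\<close>. One
    point is thereby removed, so the bound drops to \<open>m\<close>.\<close>
  define T where "T i = {p. (fst p \<circ> Suc, fst p 0) \<in> R \<and> (fst p \<circ> Suc, snd p) \<in> R
      \<and> fst p 0 \<noteq> snd p \<and> fst p 0 \<in> U i \<and> snd p \<in> U i}" for i
  have continuous_on_shift: "continuous_on UNIV (\<lambda>p :: (nat \<Rightarrow> 'a) \<times> 'a. fst p \<circ> Suc)"
    unfolding comp_def
    by (intro continuous_on_coordinatewise_then_product continuous_on_coordinate_of_pair)
  have T_meas: "T i \<in> sets borel" for i
  proof -
    have "T i = (\<lambda>p. (fst p \<circ> Suc, fst p 0)) -` R \<inter> (\<lambda>p. (fst p \<circ> Suc, snd p)) -` R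
        \<inter> (\<lambda>p. (fst p 0, snd p)) -` (- {p. fst p = snd p}) \<inter> (\<lambda>p. fst p 0) -` U i \<inter> snd -` U i"
      by (auto simp: T_def)
    also have "\<dots> \<in> sets borel"
      by (intro sets.Int borel_vimage Suc.prems(1) borel_open U_open open_Compl closed_Collect_eq
            continuous_on_Pair continuous_on_fst continuous_on_snd continuous_on_id continuous_on_coordinate_of_pair continuous_on_shift)
    finally show ?thesis .
  qed
  have sect: "{y. (w, y) \<in> T i} \<subseteq> {y. (w \<circ> Suc, y) \<in> R} - {w 0}" for w i
    by (auto simp: T_def)
  have T_fin: "finite {y. (w, y) \<in> T i}" for w i
    by (rule finite_subset[OF sect]) (simp add: Suc.prems(2))
  have T_card: "card {y. (w, y) \<in> T i} \<le> m" for w i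
  proof (cases "(w \<circ> Suc, w 0) \<in> R")
    case True
    have "card {y. (w, y) \<in> T i} \<le> card ({y. (w \<circ> Suc, y) \<in> R} - {w 0})"
      by (intro card_mono sect) (simp add: Suc.prems(2))
    also have "\<dots> = card {y. (w \<circ> Suc, y) \<in> R} - 1"
      using True by (simp add: card_Diff_singleton)
    also have "\<dots> \<le> m" using Suc.prems(3)[of "w \<circ> Suc"] by linarith
    finally show ?thesis .
  next
    case False
    then have "{y. (w, y) \<in> T i} = {}" by (auto simp: T_def)
    then show ?thesis by simp
  qed
  define Z where "Z i = {w. \<exists>y. (w, y) \<in> T i}" for i
  have Z_meas: "Z i \<in> sets borel" for i
  proof -
    obtain D g where D: "\<And>j::nat. D j \<in> sets borel"
      and eq: "\<And>w y. (w, y) \<in> T i \<longleftrightarrow> (\<exists>j. w \<in> D j \<and> y = g j w)"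
      using Suc.IH[OF T_meas[of i] T_fin T_card] by blast
    \<comment> \<open>The induction hypothesis makes this projection Borel: it is the union of the
      domains of the selectors.\<close>
    have "Z i = (\<Union>j. D j)" unfolding Z_def eq by auto
    then show ?thesis using D by auto
  qed
  \<comment> \<open>Keeps the points of \<open>R\<close> that are alone in \<open>U i\<close> within
    their section, so that \<open>Q i\<close> is functional and has a Borel selector.\<close>
  define Q where "Q i = {p \<in> R. snd p \<in> U i \<and> case_nat (snd p) (fst p) \<notin> Z i}" for i
  have Q_meas: "Q i \<in> sets borel" for i
  proof -
    have "continuous_on UNIV (\<lambda>p :: (nat \<Rightarrow> 'a) \<times> 'a. case_nat (snd p) (fst p))"
    proof (rule continuous_on_coordinatewise_then_product)
      fix i :: nat
      show "continuous_on UNIV (\<lambda>p :: (nat \<Rightarrow> 'a) \<times> 'a. case_nat (snd p) (fst p) i)"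
        by (cases i) (auto intro!: continuous_intros continuous_on_coordinate_of_pair)
    qed
    from borel_vimage[OF this borel_comp[OF Z_meas[of i]]]
    have "R \<inter> snd -` U i \<inter> (\<lambda>p. case_nat (snd p) (fst p)) -` (- Z i) \<in> sets borel"
      by (intro sets.Int Suc.prems(1) borel_vimage[of snd] borel_open[OF U_open] continuous_intros)
    also have "R \<inter> snd -` U i \<inter> (\<lambda>p. case_nat (snd p) (fst p)) -` (- Z i) = Q i"
      by (auto simp: Q_def)
    finally show ?thesis .
  qed
  have Q_iff: "(w, y) \<in> Q i \<longleftrightarrow> (w, y) \<in> R \<and> y \<in> U i \<and> (\<forall>y'. (w, y') \<in> R \<and> y' \<in> U i \<longrightarrow> y' = y)"
    for w y i
    by (auto simp: Q_def Z_def T_def comp_def)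
  have "\<exists>g. g \<in> borel_measurable borel \<and> (\<forall>w y. (w, y) \<in> Q i \<longrightarrow> g w = y)" for i
    by (rule borel_selector_of_functional_relation[OF Q_meas]) (auto simp: Q_iff)
  then obtain g where g: "\<And>i. g i \<in> borel_measurable borel" "\<And>i w y. (w, y) \<in> Q i \<Longrightarrow> g i w = y"
    by metis
  define D where "D i = {w. (w, g i w) \<in> Q i}" for i
  have "D i \<in> sets borel" for i
  proof -
    note [measurable] = Q_meas[of i] g(1)[of i]
    have [measurable]: "(\<lambda>w. (w, g i w)) \<in> borel \<rightarrow>\<^sub>M borel"
      unfolding borel_prod[symmetric] by measurable
    have "Measurable.pred borel (\<lambda>w. w \<in> D i)" unfolding D_def mem_Collect_eq by measurable
    then show ?thesis by (simp add: pred_def)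
  qed
  moreover have "(w, y) \<in> R \<longleftrightarrow> (\<exists>i. w \<in> D i \<and> y = g i w)" for w y
  proof
    assume wy: "(w, y) \<in> R"
    \<comment> \<open>Sections are finite, so some basic set isolates \<open>y\<close> from the rest
      of its section; hence the \<open>Q i\<close> exhaust \<open>R\<close>.\<close>
    have "open (- ({y'. (w, y') \<in> R} - {y}))"
      by (intro open_Compl finite_imp_closed finite_Diff Suc.prems(2))
    then obtain i where "y \<in> U i" "U i \<subseteq> - ({y'. (w, y') \<in> R} - {y})"
      using U_basis[of "- ({y'. (w, y') \<in> R} - {y})" y] by auto
    then have "(w, y) \<in> Q i" using wy by (auto simp: Q_iff)
    then show "\<exists>i. w \<in> D i \<and> y = g i w" using g(2) unfolding D_def by fastforce
  qed (auto simp: D_def Q_iff)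
  ultimately show ?case using g(1) by blast
qed

text \<open>Entry 0 of a sequence plays the base point, and pulling back along constant sequences
  returns to the original space.\<close>

proposition bounded_sections_selectors:
  fixes R :: "('a::polish_space \<times> 'a) set"
  assumes R: "R \<in> sets borel" and "\<And>x. finite {y. (x, y) \<in> R}" "\<And>x. card {y. (x, y) \<in> R} \<le> m"
  shows "\<exists>D g. (\<forall>i::nat. D i \<in> sets borel \<and> g i \<in> borel_measurable borel)
           \<and> (\<forall>x y. (x, y) \<in> R \<longleftrightarrow> (\<exists>i. x \<in> D i \<and> y = g i x))"
proof -
  define R' where "R' = {p :: (nat \<Rightarrow> 'a) \<times> 'a. (fst p 0, snd p) \<in> R}"
  have R': "R' \<in> sets borel"
  proof -
    have "R' = (\<lambda>p. (fst p 0, snd p)) -` R" by (auto simp: R'_def)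
    also have "\<dots> \<in> sets borel"
      by (intro borel_vimage R continuous_on_Pair continuous_on_snd continuous_on_id continuous_on_coordinate_of_pair)
    finally show ?thesis .
  qed
  obtain D g where D: "\<And>i::nat. D i \<in> sets borel" and g: "\<And>i::nat. g i \<in> borel_measurable borel"
    and eq: "\<And>w y. (w, y) \<in> R' \<longleftrightarrow> (\<exists>i. w \<in> D i \<and> y = g i w)"
    using bounded_sections_selectors_aux[OF R', of m] assms(2,3) unfolding R'_def by simp metis
  note [measurable] = D g
  have const[measurable]: "(\<lambda>x::'a. (\<lambda>_::nat. x)) \<in> borel \<rightarrow>\<^sub>M borel"
    by (intro measurable_coordinatewise_then_product) simp
  show ?thesis
  proof (intro exI conjI allI)
    fix i
    show "{x. (\<lambda>_. x) \<in> D i} \<in> sets borel"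
      using measurable_sets[OF const D[of i]] by (simp add: vimage_def)
    show "(\<lambda>x. g i (\<lambda>_. x)) \<in> borel_measurable borel" by measurable
  next
    fix x y
    show "(x, y) \<in> R \<longleftrightarrow> (\<exists>i. x \<in> {x. (\<lambda>_. x) \<in> D i} \<and> y = g i (\<lambda>_. x))"
      using eq[of "\<lambda>_. x" y] by (simp add: R'_def)
  qed
qed

section \<open>Balls and their isomorphism types\<close>

lemma adj_commute: "adj E x y \<longleftrightarrow> adj E y x"
  by (simp add: adj_def insert_commute eq_commute)

lemma ball_r_0: "ball_r E x 0 = {x}"
  by (auto simp: ball_r_def)

lemma ball_r_Suc: "ball_r E x (Suc r) = ball_r E x r \<union> {z. \<exists>y\<in>ball_r E x r. adj E y z}"
proof (intro equalityI subsetI)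
  fix z assume z: "z \<in> ball_r E x (Suc r)"
  then obtain i where i: "i \<le> Suc r" "(x, z) \<in> adj_rel E ^^ i" by (auto simp: ball_r_def)
  show "z \<in> ball_r E x r \<union> {z. \<exists>y\<in>ball_r E x r. adj E y z}"
  proof (cases i)
    case (Suc j)
    then obtain y where "(x, y) \<in> adj_rel E ^^ j" "adj E y z"
      using i(2) by (auto simp: adj_rel_def)
    then show ?thesis using i(1) Suc by (auto simp: ball_r_def)
  qed (use i in \<open>auto simp: ball_r_def\<close>)
next
  fix z assume "z \<in> ball_r E x r \<union> {z. \<exists>y\<in>ball_r E x r. adj E y z}"
  then consider "z \<in> ball_r E x r" | y where "y \<in> ball_r E x r" "adj E y z" by blast
  then show "z \<in> ball_r E x (Suc r)"
  proof cases
    case 1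
    then show ?thesis by (auto simp: ball_r_def intro: le_SucI)
  next
    case (2 y)
    then obtain i where "i \<le> r" "(x, y) \<in> adj_rel E ^^ i" by (auto simp: ball_r_def)
    then have "(x, z) \<in> adj_rel E ^^ Suc i" using \<open>adj E y z\<close> by (auto simp: adj_rel_def)
    then show ?thesis using \<open>i \<le> r\<close> unfolding ball_r_def by blast
  qed
qed

lemma ball_r_mono: "i \<le> j \<Longrightarrow> ball_r E x i \<subseteq> ball_r E x j"
  by (auto simp: ball_r_def intro: order_trans)

lemma centre_in_ball_r: "x \<in> ball_r E x r"
  using ball_r_mono[of 0 r E x] by (simp add: ball_r_0)

lemma component_eq_UN_ball_r: "component F x = (\<Union>r. ball_r F x r)"
  by (auto simp: component_def ball_r_def rtrancl_power)

lemma ball_r_2_commute: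
  assumes "y \<in> ball_r E x 2"
  shows "x \<in> ball_r E y 2"
  using assms by (auto simp: numeral_2_eq_2 ball_r_Suc ball_r_0 adj_commute)

text \<open>Each of the r steps has at most d + 1 choices: a neighbour, or staying put.\<close>

lemma card_ball_r_le:
  assumes "\<And>x. finite {y. adj E x y}" "\<And>x. card {y. adj E x y} \<le> d"
  shows "finite (ball_r E x r)" "card (ball_r E x r) \<le> (d + 1) ^ r"
proof -
  have "finite (ball_r E x r) \<and> card (ball_r E x r) \<le> (d + 1) ^ r"
  proof (induction r)
    case (Suc r)
    have eq: "ball_r E x (Suc r) = (\<Union>y\<in>ball_r E x r. insert y {z. adj E y z})"
      unfolding ball_r_Suc by auto
    have "card (insert y {z. adj E y z}) \<le> d + 1" for y
      using assms(2)[of y] card_insert_le_m1[of "d + 1" "{z. adj E y z}" y] by simp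
    then have "card (ball_r E x (Suc r)) \<le> card (ball_r E x r) * (d + 1)"
      unfolding eq using Suc by (intro card_UN_le[THEN order_trans] sum_bounded_above[THEN order_trans]) auto
    also have "\<dots> \<le> (d + 1) ^ r * (d + 1)"
      using Suc by (intro mult_right_mono) auto
    finally have "card (ball_r E x (Suc r)) \<le> (d + 1) ^ Suc r" by (simp add: mult.commute)
    moreover have "finite (ball_r E x (Suc r))" unfolding eq using Suc assms(1) by auto
    ultimately show ?case by blast
  qed (simp add: ball_r_0)
  then show "finite (ball_r E x r)" "card (ball_r E x r) \<le> (d + 1) ^ r" by auto
qed

text \<open>A ball that fails to grow once has stopped for good. From one vertex, r strict increases
  would give more than r vertices, so a ball of radius r with at most r vertices has already
  stopped.\<close>

lemma component_eq_ball_r: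
  assumes fin: "\<And>i. finite (ball_r F x i)" and le: "card (ball_r F x r) \<le> r"
  shows "component F x = ball_r F x r"
proof -
  have grow: "(\<forall>i<j. ball_r F x i \<noteq> ball_r F x (Suc i)) \<Longrightarrow> j < card (ball_r F x j)" for j
  proof (induction j)
    case (Suc j)
    then have "ball_r F x j \<subset> ball_r F x (Suc j)" using ball_r_mono[of j "Suc j" F x] by auto
    then have "card (ball_r F x j) < card (ball_r F x (Suc j))" by (intro psubset_card_mono fin)
    then show ?case using Suc by auto
  qed (simp add: ball_r_0)
  then have "\<not> (\<forall>i<r. ball_r F x i \<noteq> ball_r F x (Suc i))" using le by (meson linorder_not_less)
  then obtain i where i: "i < r" "ball_r F x i = ball_r F x (Suc i)" by blast
  have closed: "{z. \<exists>y\<in>ball_r F x i. adj F y z} \<subseteq> ball_r F x i"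
    using i(2) unfolding ball_r_Suc by blast
  have "ball_r F x (i + k) = ball_r F x i" for k
  proof (induction k)
    case (Suc k)
    show ?case unfolding add_Suc_right ball_r_Suc Suc.IH using closed by blast
  qed simp
  then have stable: "ball_r F x m = ball_r F x i" if "m \<ge> i" for m
    using that by (metis le_add_diff_inverse)
  have "ball_r F x m \<subseteq> ball_r F x r" for m
    using stable[of "max m i"] stable[of r] i(1) ball_r_mono[of m "max m i" F x] by auto
  then show ?thesis unfolding component_eq_UN_ball_r by auto
qed

text \<open>With m the size of the r-ball, the threshold r is where
  \<open>component_eq_ball_r\<close> certifies that the ball is the whole component.\<close>

definition truncated_inverse :: "nat \<Rightarrow> nat \<Rightarrow> real" where
  "truncated_inverse r m = (if m \<le> r then 1 / real m else 0)"

lemma abs_truncated_inverse_le_1: "\<bar>truncated_inverse r m\<bar> \<le> 1"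
  by (auto simp: truncated_inverse_def divide_le_eq_1)

text \<open>Either the ball is the component and the error is 0, or the component has more than r
  vertices. An infinite component has \<open>card\<close> 0, hence reciprocal 0, as the convention
  1/\<infinity> = 0 demands.\<close>

lemma inverse_card_component_approx:
  assumes fin: "\<And>i. finite (ball_r F x i)" and "r > 0"
  shows "\<bar>1 / real (card (component F x)) - truncated_inverse r (card (ball_r F x r))\<bar> \<le> 1 / real r"
proof (cases "card (ball_r F x r) \<le> r")
  case True
  then show ?thesis using component_eq_ball_r[OF fin True] by (simp add: truncated_inverse_def)
next
  case False
  have "1 / real (card (component F x)) \<le> 1 / real r"
  proof (cases "finite (component F x)")
    case True
    have "r \<le> card (ball_r F x r)" using False by simp
    also have "\<dots> \<le> card (component F x)"
      by (intro card_mono True) (auto simp: component_eq_UN_ball_r)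
    finally show ?thesis using \<open>r > 0\<close> by (intro divide_left_mono) auto
  qed simp
  then show ?thesis using False by (simp add: truncated_inverse_def)
qed

text \<open>Serves measurability: the reciprocal component size becomes a pointwise limit of
  functions of finite balls.\<close>

lemma truncated_inverse_tendsto:
  assumes "\<And>i. finite (ball_r F x i)"
  shows "(\<lambda>r. truncated_inverse r (card (ball_r F x r))) \<longlonglongrightarrow> 1 / real (card (component F x))"
proof (rule Lim_transform2[OF tendsto_const])
  have "(\<lambda>r. 1 / real r) \<longlonglongrightarrow> 0" by (rule lim_1_over_n)
  then show "(\<lambda>r. 1 / real (card (component F x)) - truncated_inverse r (card (ball_r F x r)))
      \<longlonglongrightarrow> 0"
    by (rule Lim_null_comparison[rotated])
       (use inverse_card_component_approx[OF assms] in \<open>auto intro!: eventually_sequentiallyI[of 1]\<close>)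
qed

section \<open>Filtering edges by labels read off from vertex colours\<close>

definition edge_filter ::
  "'v set set \<Rightarrow> ('v \<Rightarrow> nat) \<Rightarrow> (nat \<Rightarrow> nat \<Rightarrow> nat) \<Rightarrow> nat set \<Rightarrow> 'v set set" where
  "edge_filter E c \<phi> S = {e \<in> E. \<exists>u v. e = {u, v} \<and> u \<noteq> v \<and> \<phi> (c u) (c v) \<in> S}"

lemma adj_edge_filter:
  assumes "\<And>a b. \<phi> a b = \<phi> b a"
  shows "adj (edge_filter E c \<phi> S) x y \<longleftrightarrow> adj E x y \<and> \<phi> (c x) (c y) \<in> S"
proof
  assume "adj (edge_filter E c \<phi> S) x y"
  then show "adj E x y \<and> \<phi> (c x) (c y) \<in> S"
    using assms by (auto simp: adj_def edge_filter_def doubleton_eq_iff)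
qed (auto simp: adj_def edge_filter_def)

text \<open>The filter carried out on a representative, so that the filtered ball is computable from
  the isomorphism type. Loops arising from i = j are ignored by \<open>adj\<close>.\<close>

definition rep_filter :: "(nat \<Rightarrow> nat \<Rightarrow> nat) \<Rightarrow> nat set \<Rightarrow> rooted_rep \<Rightarrow> nat set set" where
  "rep_filter \<phi> S B = (case B of (n, Eb, col) \<Rightarrow>
     {e. \<exists>i<n. \<exists>j<n. e = {i, j} \<and> {i, j} \<in> Eb \<and> \<phi> (col i) (col j) \<in> S})"

text \<open>Filtering only removes edges, so r steps from \<open>x\<close> in the filtered graph
  stay inside the r-ball of \<open>E\<close>, where the isomorphism knows edges and colours.\<close>

lemma card_filtered_ball_eq:
  assumes sym: "\<And>a b. \<phi> a b = \<phi> b a" and iso: "ball_iso E c r x B"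
  shows "card (ball_r (edge_filter E c \<phi> S) x r) = card (ball_r (rep_filter \<phi> S B) 0 r)"
proof -
  obtain n Eb col where B: "B = (n, Eb, col)" by (cases B)
  obtain f where f: "bij_betw f {..<n} (ball_r E x r)" "f 0 = x"
    "\<And>i j. i < n \<Longrightarrow> j < n \<Longrightarrow> {i, j} \<in> Eb \<longleftrightarrow> adj E (f i) (f j)"
    "\<And>i. i < n \<Longrightarrow> col i = c (f i)"
    using iso unfolding ball_iso_def B by auto
  let ?F = "edge_filter E c \<phi> S" and ?H = "rep_filter \<phi> S B"
  have "n > 0" using f(1) centre_in_ball_r[of x E r] by (auto simp: bij_betw_def)
  have adj_H: "adj ?H i j \<longleftrightarrow> i < n \<and> j < n \<and> adj ?F (f i) (f j)" for i j
  proof -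
    have "adj ?H i j \<longleftrightarrow> i < n \<and> j < n \<and> i \<noteq> j \<and> {i, j} \<in> Eb \<and> \<phi> (col i) (col j) \<in> S"
      using sym by (auto simp: adj_def rep_filter_def B doubleton_eq_iff insert_commute)
    moreover have "adj E (f i) (f j) \<Longrightarrow> i \<noteq> j" by (auto simp: adj_def)
    ultimately show ?thesis
      using f(3,4) by (auto simp: adj_edge_filter[OF sym])
  qed
  have "ball_r ?H 0 i \<subseteq> {..<n} \<and> ball_r ?F x i = f ` ball_r ?H 0 i" if "i \<le> r" for i
    using that
  proof (induction i)
    case 0
    then show ?case using \<open>n > 0\<close> f(2) by (simp add: ball_r_0)
  next
    case (Suc i)
    then have IH: "ball_r ?H 0 i \<subseteq> {..<n}" "ball_r ?F x i = f ` ball_r ?H 0 i" by auto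
    have sub: "ball_r ?F x j \<subseteq> ball_r E x j" for j
    proof (induction j)
      case (Suc j)
      then show ?case by (auto simp: ball_r_Suc adj_edge_filter[OF sym])
    qed (simp add: ball_r_0)
    have 1: "ball_r ?H 0 (Suc i) \<subseteq> {..<n}"
      using IH(1) by (auto simp: ball_r_Suc adj_H)
    have "ball_r ?F x (Suc i) \<subseteq> f ` ball_r ?H 0 (Suc i)"
    proof
      fix z assume z: "z \<in> ball_r ?F x (Suc i)"
      then consider "z \<in> ball_r ?F x i" | y where "y \<in> ball_r ?F x i" "adj ?F y z"
        by (auto simp: ball_r_Suc)
      then show "z \<in> f ` ball_r ?H 0 (Suc i)"
      proof cases
        case 1
        then show ?thesis using IH(2) by (auto simp: ball_r_Suc)
      next
        case (2 y)
        have "z \<in> ball_r E x r"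
          using z sub[of "Suc i"] ball_r_mono[of "Suc i" r E x] Suc.prems by blast
        then obtain b where b: "b < n" "z = f b" using f(1) by (auto simp: bij_betw_def)
        obtain a where "a \<in> ball_r ?H 0 i" "y = f a" using 2 IH by auto
        then have "b \<in> ball_r ?H 0 (Suc i)" using b 2 IH(1) by (auto simp: ball_r_Suc adj_H)
        then show ?thesis using b by blast
      qed
    qed
    moreover have "f ` ball_r ?H 0 (Suc i) \<subseteq> ball_r ?F x (Suc i)"
      using IH(2) by (auto simp: ball_r_Suc adj_H)
    ultimately show ?case using 1 by blast
  qed
  from this[of r] show ?thesis
    using f(1) by (metis bij_betw_def card_image inj_on_subset order_refl)
qed

section \<open>Finitely many isomorphism types of balls\<close>

definition rep_equiv :: "rooted_rep \<Rightarrow> rooted_rep \<Rightarrow> bool" where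
  "rep_equiv B B' \<longleftrightarrow> (case B of (n, Eb, col) \<Rightarrow> case B' of (n', Eb', col') \<Rightarrow>
     n = n' \<and> (\<exists>\<pi>. bij_betw \<pi> {..<n} {..<n} \<and> \<pi> 0 = 0 \<and>
       (\<forall>i<n. \<forall>j<n. {i, j} \<in> Eb' \<longleftrightarrow> {\<pi> i, \<pi> j} \<in> Eb) \<and> (\<forall>i<n. col' i = col (\<pi> i))))"

text \<open>Two isomorphisms onto the same ball differ by a permutation of the indices. So which
  other representatives fit is decided by \<open>B\<close>, not by the graph or the vertex.\<close>

lemma ball_iso_iff_rep_equiv:
  assumes "ball_iso E c r x B"
  shows "ball_iso E c r x B' \<longleftrightarrow> rep_equiv B B'"
proof -
  obtain n Eb col where B: "B = (n, Eb, col)" by (cases B)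
  obtain n' Eb' col' where B': "B' = (n', Eb', col')" by (cases B')
  obtain f where f: "bij_betw f {..<n} (ball_r E x r)" "f 0 = x"
    "\<And>i j. i < n \<Longrightarrow> j < n \<Longrightarrow> {i, j} \<in> Eb \<longleftrightarrow> adj E (f i) (f j)"
    "\<And>i. i < n \<Longrightarrow> col i = c (f i)"
    using assms unfolding ball_iso_def B by auto
  have n: "n > 0" using f(1) centre_in_ball_r[of x E r] by (auto simp: bij_betw_def)
  show ?thesis
  proof
    assume "ball_iso E c r x B'"
    then obtain g where g: "bij_betw g {..<n'} (ball_r E x r)" "g 0 = x"
      "\<And>i j. i < n' \<Longrightarrow> j < n' \<Longrightarrow> {i, j} \<in> Eb' \<longleftrightarrow> adj E (g i) (g j)"
      "\<And>i. i < n' \<Longrightarrow> col' i = c (g i)"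
      unfolding ball_iso_def B' by auto
    have "n = n'" using bij_betw_same_card[OF f(1)] bij_betw_same_card[OF g(1)] by simp
    define \<pi> where "\<pi> = inv_into {..<n} f \<circ> g"
    have bij: "bij_betw \<pi> {..<n} {..<n}"
      unfolding \<pi>_def using bij_betw_trans[OF g(1) bij_betw_inv_into[OF f(1)]] \<open>n = n'\<close> by simp
    have f\<pi>: "f (\<pi> i) = g i" if "i < n" for i
      using that g(1) f(1) \<open>n = n'\<close> unfolding \<pi>_def
      by (auto simp: bij_betw_def intro!: f_inv_into_f)
    have \<pi>_less: "\<pi> i < n" if "i < n" for i using bij that by (auto simp: bij_betw_def)
    have "\<pi> 0 = 0"
      unfolding \<pi>_def using f(1,2) g(2) n by (simp add: bij_betw_def inv_into_f_eq)
    then show "rep_equiv B B'"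
      unfolding rep_equiv_def B B'
      using bij f\<pi> \<pi>_less f(3,4) g(3,4) \<open>n = n'\<close> by auto
  next
    assume "rep_equiv B B'"
    then obtain \<pi> where \<pi>: "n = n'" "bij_betw \<pi> {..<n} {..<n}" "\<pi> 0 = 0"
       "\<And>i j. i < n \<Longrightarrow> j < n \<Longrightarrow> {i, j} \<in> Eb' \<longleftrightarrow> {\<pi> i, \<pi> j} \<in> Eb"
       "\<And>i. i < n \<Longrightarrow> col' i = col (\<pi> i)"
      unfolding rep_equiv_def B B' by auto
    have \<pi>_less: "\<pi> i < n" if "i < n" for i using \<pi>(2) that by (auto simp: bij_betw_def)
    show "ball_iso E c r x B'"
      unfolding ball_iso_def B' prod.case
      using bij_betw_trans[OF \<pi>(2) f(1)] \<pi> f \<pi>_less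
      by (intro exI[of _ "f \<circ> \<pi>"]) (auto simp: comp_def)
  qed
qed

text \<open>Colours beyond n are pinned to 0, since otherwise their free choice would make the set
  infinite.\<close>

definition bounded_reps :: "nat \<Rightarrow> nat \<Rightarrow> rooted_rep set" where
  "bounded_reps N K = {(n, Eb, col). n \<le> N \<and> Eb \<subseteq> Pow {..<n} \<and>
     (\<forall>i. (i < n \<longrightarrow> col i < K) \<and> (n \<le> i \<longrightarrow> col i = 0))}"

lemma finite_bounded_reps: "finite (bounded_reps N K)"
proof -
  have "bounded_reps N K \<subseteq> {..N} \<times> Pow (Pow {..<N}) \<times>
          {col. \<forall>i. (i \<in> {..<N} \<longrightarrow> col i \<in> {..K}) \<and> (i \<notin> {..<N} \<longrightarrow> col i = 0)}"
  proof
    fix B assume "B \<in> bounded_reps N K"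
    then obtain n Eb col where B: "B = (n, Eb, col)" "n \<le> N" "Eb \<subseteq> Pow {..<n}"
        "\<And>i. i < n \<Longrightarrow> col i < K" "\<And>i. n \<le> i \<Longrightarrow> col i = 0"
      by (auto simp: bounded_reps_def)
    have "Pow {..<n} \<subseteq> Pow {..<N}" using B(2) by auto
    moreover have "col i \<le> K" for i using B(4,5)[of i] by (cases "i < n") auto
    ultimately show "B \<in> {..N} \<times> Pow (Pow {..<N}) \<times>
          {col. \<forall>i. (i \<in> {..<N} \<longrightarrow> col i \<in> {..K}) \<and> (i \<notin> {..<N} \<longrightarrow> col i = 0)}"
      using B by auto
  qed
  then show ?thesis
    by (rule finite_subset) (intro finite_cartesian_product finite_set_of_finite_funs; simp)
qed

lemma ex_bounded_rep:
  assumes fin: "finite (ball_r E x r)" and "card (ball_r E x r) \<le> N"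
    and col: "\<And>y. y \<in> ball_r E x r \<Longrightarrow> c y < K"
  shows "\<exists>B\<in>bounded_reps N K. ball_iso E c r x B"
proof -
  define n where "n = card (ball_r E x r)"
  obtain h where h: "bij_betw h {..<n} (ball_r E x r)"
    using ex_bij_betw_nat_finite[OF fin] by (auto simp: n_def atLeast0LessThan)
  obtain p where p: "p < n" "h p = x"
    using h centre_in_ball_r[of x E r] by (metis bij_betw_imp_surj_on imageE lessThan_iff)
  \<comment> \<open>The transposition moves the root to index 0, as \<open>ball_iso\<close>
    demands.\<close>
  define f where "f = h \<circ> Transposition.transpose 0 p"
  have "bij_betw (Transposition.transpose 0 p) {..<n} {..<n}"
    using p(1) by (intro permutes_imp_bij permutes_swap_id) auto
  from bij_betw_trans[OF this h] have f: "bij_betw f {..<n} (ball_r E x r)" "f 0 = x"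
    using p by (simp_all add: f_def)
  define B :: rooted_rep where
    "B = (n, {e. \<exists>i<n. \<exists>j<n. e = {i, j} \<and> adj E (f i) (f j)}, \<lambda>i. if i < n then c (f i) else 0)"
  have "ball_iso E c r x B"
    unfolding ball_iso_def B_def prod.case
    by (intro exI[of _ f]) (use f in \<open>auto simp: doubleton_eq_iff intro: adj_commute[THEN iffD1]\<close>)
  moreover have "f i \<in> ball_r E x r" if "i < n" for i
    using f that by (auto simp: bij_betw_def)
  then have "B \<in> bounded_reps N K"
    using assms(2) col by (auto simp: B_def bounded_reps_def n_def)
  ultimately show ?thesis by blast
qed

text \<open>Isomorphic representatives are counted with the reciprocal of the size of their class.\<close>

lemma sum_over_reps:
  fixes h :: "rooted_rep \<Rightarrow> real"
  assumes "\<exists>B\<in>\<R>. ball_iso E c r x B" "finite \<R>"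
    and h: "\<And>B. B \<in> \<R> \<Longrightarrow> ball_iso E c r x B \<Longrightarrow> h B = v"
  shows "(\<Sum>B\<in>\<R>. of_bool (ball_iso E c r x B) * (h B / real (card {B' \<in> \<R>. rep_equiv B B'}))) = v"
proof -
  define T where "T = {B \<in> \<R>. ball_iso E c r x B}"
  have "finite T" "T \<noteq> {}" using assms by (auto simp: T_def)
  have "{B' \<in> \<R>. rep_equiv B B'} = T" if "B \<in> T" for B
    using ball_iso_iff_rep_equiv[of E c r x B] that by (auto simp: T_def)
  then have "(\<Sum>B\<in>T. h B / real (card {B' \<in> \<R>. rep_equiv B B'})) = (\<Sum>B\<in>T. v / real (card T))"
    using h by (intro sum.cong) (auto simp: T_def)
  also have "\<dots> = v" using \<open>finite T\<close> \<open>T \<noteq> {}\<close> by simp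
  also have "(\<Sum>B\<in>T. h B / real (card {B' \<in> \<R>. rep_equiv B B'}))
      = (\<Sum>B\<in>\<R>. of_bool (ball_iso E c r x B) * (h B / real (card {B' \<in> \<R>. rep_equiv B B'})))"
    unfolding T_def sum.inter_filter[OF assms(2)] by (intro sum.cong) auto
  finally show ?thesis .
qed

section \<open>Borel graphs of bounded degree\<close>

text \<open>Words of indices are countably many names for the vertices near \<open>x\<close>. The
  last letter acts first.\<close>

primrec walk :: "(nat \<Rightarrow> 'a \<Rightarrow> 'a) \<Rightarrow> nat list \<Rightarrow> 'a \<Rightarrow> 'a" where
  "walk nbr [] x = x"
| "walk nbr (i # w) x = nbr i (walk nbr w x)"

text \<open>Common ground of graphings and finite graphs. A measurable diagonal stands in for a
  topology on the vertices and makes vertex equality a measurable condition; \<open>x\<close>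
  belongs to the range of the neighbour maps so that walks may pause.\<close>

locale borel_graph = prob_space M for M :: "'a measure" +
  fixes E :: "'a set set" and nbr :: "nat \<Rightarrow> 'a \<Rightarrow> 'a" and d :: nat
  assumes space_UNIV: "space M = UNIV"
    and edge_doubleton: "e \<in> E \<Longrightarrow> \<exists>x y. x \<noteq> y \<and> e = {x, y}"
    and adj_sets: "{p. adj E (fst p) (snd p)} \<in> sets (M \<Otimes>\<^sub>M M)"
    and diagonal_sets: "{p. fst p = snd p} \<in> sets (M \<Otimes>\<^sub>M M)"
    and nbr_measurable: "nbr i \<in> M \<rightarrow>\<^sub>M M"
    and range_nbr: "range (\<lambda>i. nbr i x) = insert x {y. adj E x y}"
    and finite_nbrs: "finite {y. adj E x y}"
    and degree_le: "card {y. adj E x y} \<le> d"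
begin

lemma pred_adj:
  assumes "f \<in> N \<rightarrow>\<^sub>M M" "g \<in> N \<rightarrow>\<^sub>M M"
  shows "Measurable.pred N (\<lambda>x. adj E (f x) (g x))"
proof -
  have "(\<lambda>x. (f x, g x)) \<in> N \<rightarrow>\<^sub>M M \<Otimes>\<^sub>M M" using assms by measurable
  from measurable_sets[OF this adj_sets] show ?thesis
    by (simp add: pred_def vimage_def Int_def conj_commute)
qed

lemma pred_vertex_eq:
  assumes "f \<in> N \<rightarrow>\<^sub>M M" "g \<in> N \<rightarrow>\<^sub>M M"
  shows "Measurable.pred N (\<lambda>x. f x = g x)"
proof -
  have "(\<lambda>x. (f x, g x)) \<in> N \<rightarrow>\<^sub>M M \<Otimes>\<^sub>M M" using assms by measurable
  from measurable_sets[OF this diagonal_sets] show ?thesis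
    by (simp add: pred_def vimage_def Int_def conj_commute)
qed

lemma walk_measurable[measurable]: "walk nbr w \<in> M \<rightarrow>\<^sub>M M"
proof (induction w)
  case (Cons i w)
  have "(\<lambda>x. nbr i (walk nbr w x)) \<in> M \<rightarrow>\<^sub>M M"
    by (rule measurable_compose[OF Cons nbr_measurable])
  then show ?case by (simp add: fun_eq_iff[THEN iffD2])
next
  case Nil
  have "walk nbr [] = (\<lambda>x. x)" by auto
  then show ?case by simp
qed

text \<open>Since walks may pause, words of length exactly r also reach the vertices at smaller
  distance.\<close>

lemma ball_r_eq_walks: "ball_r E x r = (\<lambda>w. walk nbr w x) ` {w. length w = r}"
proof (induction r)
  case (Suc r)
  have "ball_r E x (Suc r) = (\<Union>y\<in>ball_r E x r. insert y {z. adj E y z})"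
    unfolding ball_r_Suc by auto
  also have "\<dots> = (\<Union>w\<in>{w. length w = r}. range (\<lambda>i. nbr i (walk nbr w x)))"
    unfolding Suc range_nbr by auto
  also have "\<dots> = (\<lambda>w. walk nbr w x) ` {w. length w = Suc r}"
    by (force simp: length_Suc_conv)
  finally show ?case .
qed (simp add: ball_r_0)

lemma finite_ball_r: "finite (ball_r E x r)"
  by (rule card_ball_r_le(1)[OF finite_nbrs degree_le])

lemma card_ball_r: "card (ball_r E x r) \<le> (d + 1) ^ r"
  by (rule card_ball_r_le(2)[OF finite_nbrs degree_le])

text \<open>A list of words naming the values of the isomorphism replaces the isomorphism, so every
  quantifier is countable. The root is written \<open>walk nbr [] x\<close> so that each condition
  on \<open>x\<close> is an equality or adjacency of two walks or the colour of one.\<close>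

lemma ball_iso_iff_walks:
  "ball_iso E c r x (n, Eb, col) \<longleftrightarrow> 0 < n \<and> (\<exists>ws. length ws = n
     \<and> (\<forall>i. i < n \<longrightarrow> length (ws ! i) = r)
     \<and> (\<forall>i j. i < n \<longrightarrow> j < n \<longrightarrow> i \<noteq> j \<longrightarrow> walk nbr (ws ! i) x \<noteq> walk nbr (ws ! j) x)
     \<and> (\<forall>w. length w = r \<longrightarrow> (\<exists>i. i < n \<and> walk nbr w x = walk nbr (ws ! i) x))
     \<and> walk nbr (ws ! 0) x = walk nbr [] x
     \<and> (\<forall>i j. i < n \<longrightarrow> j < n \<longrightarrow> {i, j} \<in> Eb \<longleftrightarrow> adj E (walk nbr (ws ! i) x) (walk nbr (ws ! j) x))
     \<and> (\<forall>i. i < n \<longrightarrow> col i = c (walk nbr (ws ! i) x)))" (is "?L \<longleftrightarrow> 0 < n \<and> (\<exists>ws. ?R ws)")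
proof
  assume ?L
  then obtain f where f: "bij_betw f {..<n} (ball_r E x r)" "f 0 = x"
    "\<And>i j. i < n \<Longrightarrow> j < n \<Longrightarrow> {i, j} \<in> Eb \<longleftrightarrow> adj E (f i) (f j)"
    "\<And>i. i < n \<Longrightarrow> col i = c (f i)"
    unfolding ball_iso_def by auto
  have n: "n > 0" using f(1) centre_in_ball_r[of x E r] by (auto simp: bij_betw_def)
  have "\<exists>w. length w = r \<and> walk nbr w x = f i" if "i < n" for i
  proof -
    have "f i \<in> ball_r E x r" using f(1) that by (auto simp: bij_betw_def)
    then show ?thesis unfolding ball_r_eq_walks by auto
  qed
  then obtain v where v: "\<And>i. i < n \<Longrightarrow> length (v i) = r" "\<And>i. i < n \<Longrightarrow> walk nbr (v i) x = f i"
    by metis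
  have surj: "\<exists>i. i < n \<and> walk nbr w x = walk nbr (map v [0..<n] ! i) x" if "length w = r" for w
  proof -
    have "walk nbr w x \<in> ball_r E x r" using that unfolding ball_r_eq_walks by auto
    then obtain i where "i < n" "walk nbr w x = f i" using f(1) by (auto simp: bij_betw_def)
    then show ?thesis using v(2) by (intro exI[of _ i]) simp
  qed
  have inj: "i = j" if "i < n" "j < n" "f i = f j" for i j
    using f(1) that by (auto simp: bij_betw_def inj_on_def)
  have R: "?R (map v [0..<n])"
    using n v f(2-) surj inj by (auto 0 3)
  show "0 < n \<and> (\<exists>ws. ?R ws)" by (rule conjI[OF n exI[where P = "\<lambda>ws. ?R ws", OF R]])
next
  assume H: "0 < n \<and> (\<exists>ws. ?R ws)"
  obtain ws where ws: "?R ws" using H[THEN conjunct2] by (rule exE)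
  define f where "f i = walk nbr (ws ! i) x" for i
  note ws = ws[folded f_def]
  note ws1 = ws[THEN conjunct2]
  note ws2 = ws1[THEN conjunct2] note ws3 = ws2[THEN conjunct2] note ws4 = ws3[THEN conjunct2]
  have len: "\<And>i. i < n \<Longrightarrow> length (ws ! i) = r" using ws1[THEN conjunct1] by blast
  have "inj_on f {..<n}" using ws2[THEN conjunct1] by (auto simp: inj_on_def)
  moreover have "f ` {..<n} \<subseteq> ball_r E x r"
    unfolding f_def ball_r_eq_walks using len by auto
  moreover have "ball_r E x r \<subseteq> f ` {..<n}"
    using ws3[THEN conjunct1] unfolding ball_r_eq_walks by auto
  ultimately have "bij_betw f {..<n} (ball_r E x r)" by (simp add: bij_betw_def subset_antisym)
  moreover have "f 0 = x" using ws4[THEN conjunct1] by simp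
  ultimately show ?L
    unfolding ball_iso_def prod.case
    using ws4[THEN conjunct2] by (intro exI[of _ f]) simp
qed

lemma ball_iso_measurable:
  assumes [measurable]: "c \<in> M \<rightarrow>\<^sub>M count_space UNIV"
  shows "Measurable.pred M (\<lambda>x. ball_iso E c r x B)"
proof -
  obtain n Eb col where B: "B = (n, Eb, col)" by (cases B)
  have [measurable]: "Measurable.pred M (\<lambda>x. walk nbr w x = walk nbr w' x)"
      "Measurable.pred M (\<lambda>x. adj E (walk nbr w x) (walk nbr w' x))" for w w'
    by (intro pred_vertex_eq pred_adj walk_measurable)+
  have [measurable]: "Measurable.pred M (\<lambda>x. a = c (walk nbr w x))" for w a
    by measurable
  show ?thesis unfolding B ball_iso_iff_walks by measurable
qed

end

text \<open>Linear in the ball statistics \<open>P\<close>, with coefficients determined by the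
  types. For \<open>P_gr\<close> and a list of all occurring types it is the mean of
  \<open>truncated_inverse\<close> at the size of the filtered r-ball.\<close>

definition ball_estimate ::
  "(nat \<Rightarrow> nat \<Rightarrow> nat) \<Rightarrow> nat set \<Rightarrow> nat \<Rightarrow> rooted_rep set \<Rightarrow> (rooted_rep \<Rightarrow> real) \<Rightarrow> real" where
  "ball_estimate \<phi> S r \<R> P = (\<Sum>B\<in>\<R>. P B *
     (truncated_inverse r (card (ball_r (rep_filter \<phi> S B) 0 r)) / real (card {B' \<in> \<R>. rep_equiv B B'})))"

text \<open>All coefficients are at most 1 in absolute value. The list of types will depend only on
  d, r and K, so the factor is the same for all graphs of a sequence.\<close>

lemma ball_estimate_lipschitz:
  assumes "\<And>B. B \<in> \<R> \<Longrightarrow> \<bar>P B - Q B\<bar> \<le> \<delta>"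
  shows "\<bar>ball_estimate \<phi> S r \<R> P - ball_estimate \<phi> S r \<R> Q\<bar> \<le> real (card \<R>) * \<delta>"
proof -
  define h where "h B = truncated_inverse r (card (ball_r (rep_filter \<phi> S B) 0 r))
      / real (card {B' \<in> \<R>. rep_equiv B B'})" for B
  have h: "\<bar>h B\<bar> \<le> 1" for B
  proof -
    have "\<bar>a / real m\<bar> \<le> 1" if "\<bar>a\<bar> \<le> 1" for a m
      using that by (cases "m = 0") (auto simp: divide_le_eq_1)
    then show ?thesis unfolding h_def using abs_truncated_inverse_le_1 by blast
  qed
  have "\<bar>ball_estimate \<phi> S r \<R> P - ball_estimate \<phi> S r \<R> Q\<bar> = \<bar>\<Sum>B\<in>\<R>. (P B - Q B) * h B\<bar>"
    unfolding ball_estimate_def h_def[symmetric] by (simp add: sum_subtractf left_diff_distrib)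
  also have "\<dots> \<le> (\<Sum>B\<in>\<R>. \<bar>(P B - Q B) * h B\<bar>)" by (rule sum_abs)
  also have "\<dots> \<le> (\<Sum>B\<in>\<R>. \<delta>)"
  proof (rule sum_mono)
    fix B assume "B \<in> \<R>"
    have "\<bar>P B - Q B\<bar> * \<bar>h B\<bar> \<le> \<bar>P B - Q B\<bar> * 1" by (intro mult_left_mono h) auto
    then show "\<bar>(P B - Q B) * h B\<bar> \<le> \<delta>" using assms[OF \<open>B \<in> \<R>\<close>] by (simp add: abs_mult)
  qed
  finally show ?thesis by simp
qed

context borel_graph
begin

text \<open>One minus the rank is the mean of the reciprocal component size \<open>u\<close>. The
  function \<open>h r\<close> is uniformly within 1 / r of \<open>u\<close> and is a finite
  combination of indicators of ball types, so its integral is the estimate.\<close>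

lemma graphing_rank_approx:
  fixes c :: "'a \<Rightarrow> nat"
  assumes c[measurable]: "c \<in> M \<rightarrow>\<^sub>M count_space UNIV" and cK: "\<And>x. c x < K"
    and sym: "\<And>a b. \<phi> a b = \<phi> b a" and "r > 0"
  shows "\<bar>1 - graphing_rank M (edge_filter E c \<phi> S)
      - ball_estimate \<phi> S r (bounded_reps ((d + 1) ^ r) K) (P_gr M E r c)\<bar> \<le> 1 / real r"
proof -
  let ?F = "edge_filter E c \<phi> S"
  define \<R> where "\<R> r = bounded_reps ((d + 1) ^ r) K" for r
  define H where "H r B = truncated_inverse r (card (ball_r (rep_filter \<phi> S B) 0 r))" for r B
  define W where "W r B = real (card {B' \<in> \<R> r. rep_equiv B B'})" for r B
  define h where "h r x = truncated_inverse r (card (ball_r ?F x r))" for r x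
  have fin\<R>: "finite (\<R> r)" for r by (simp add: \<R>_def finite_bounded_reps)
  have sub: "{y. adj ?F x y} \<subseteq> {y. adj E x y}" for x by (auto simp: adj_edge_filter[OF sym])
  have finF: "finite (ball_r ?F x i)" for x i
    by (rule card_ball_r_le(1)[of _ d])
       (use finite_subset[OF sub finite_nbrs] card_mono[OF finite_nbrs sub] degree_le
         in \<open>auto intro: order_trans\<close>)
  have h_eq: "h r x = (\<Sum>B\<in>\<R> r. of_bool (ball_iso E c r x B) * (H r B / W r B))" for r x
  proof -
    have "\<exists>B\<in>\<R> r. ball_iso E c r x B"
      unfolding \<R>_def by (rule ex_bounded_rep[OF finite_ball_r card_ball_r cK])
    then show ?thesis
      unfolding W_def
      by (rule sum_over_reps[symmetric, OF _ fin\<R>]) (simp add: H_def h_def card_filtered_ball_eq[OF sym])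
  qed
  have iso_sets: "{x. ball_iso E c r x B} \<in> sets M" for r B
    using ball_iso_measurable[OF c] by (simp add: pred_def space_UNIV)
  have ind: "of_bool (ball_iso E c r x B) = (indicator {x. ball_iso E c r x B} x :: real)" for r x B
    by simp
  have h_meas[measurable]: "h r \<in> borel_measurable M" for r
  proof -
    have "(\<lambda>x. \<Sum>B\<in>\<R> r. of_bool (ball_iso E c r x B) * (H r B / W r B)) \<in> borel_measurable M"
      unfolding ind
      by (intro borel_measurable_sum borel_measurable_times borel_measurable_indicator
            borel_measurable_const iso_sets)
    then show ?thesis by (simp add: h_eq[abs_def])
  qed
  have int_h: "(\<integral>x. h r x \<partial>M) = ball_estimate \<phi> S r (\<R> r) (P_gr M E r c)" for r
  proof -
    have "(\<integral>x. h r x \<partial>M) = (\<Sum>B\<in>\<R> r. (\<integral>x. indicator {x. ball_iso E c r x B} x * (H r B / W r B) \<partial>M))"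
      unfolding h_eq ind
      by (intro Bochner_Integration.integral_sum integrable_mult_left)
         (simp add: iso_sets less_top[symmetric])
    also have "\<dots> = (\<Sum>B\<in>\<R> r. P_gr M E r c B * (H r B / W r B))"
      using iso_sets by (intro sum.cong) (simp_all add: P_gr_def space_UNIV)
    finally show ?thesis by (simp add: ball_estimate_def H_def W_def)
  qed
  define u where "u x = 1 / real (card (component ?F x))" for x
  \<comment> \<open>The limit runs over all radii, which is why \<open>h\<close> and its expansion
    are set up for every r.\<close>
  have u_meas[measurable]: "u \<in> borel_measurable M"
  proof (rule borel_measurable_LIMSEQ_metric)
    show "(\<lambda>r. h r x) \<longlonglongrightarrow> u x" for x
      unfolding h_def u_def by (rule truncated_inverse_tendsto[OF finF])
  qed simp
  have int_u: "integrable M u"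
    by (rule integrable_const_bound[where B = 1]) (auto simp: u_def divide_le_eq_1)
  have int_h': "integrable M (h r)"
    by (rule integrable_const_bound[where B = 1]) (auto simp: h_def abs_truncated_inverse_le_1)
  have bound: "\<bar>u x - h r x\<bar> \<le> 1 / real r" for x
    unfolding u_def h_def by (rule inverse_card_component_approx[OF finF \<open>r > 0\<close>])
  have "\<bar>(\<integral>x. u x \<partial>M) - (\<integral>x. h r x \<partial>M)\<bar> = \<bar>\<integral>x. u x - h r x \<partial>M\<bar>"
    using int_u int_h' by simp
  also have "\<dots> \<le> (\<integral>x. \<bar>u x - h r x\<bar> \<partial>M)" by (rule integral_abs_bound)
  also have "\<dots> \<le> (\<integral>x. 1 / real r \<partial>M)"
    using int_u int_h' bound by (intro integral_mono) auto
  also have "\<dots> = 1 / real r" by (simp add: prob_space)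
  finally show ?thesis unfolding int_h by (simp add: graphing_rank_def u_def \<R>_def)
qed

end

section \<open>Encoding edge labellings by vertex colourings\<close>

text \<open>Vertices are coloured in the order of their \<kappa>-values, each with the least colour
  not yet taken within distance 2. Vertices of equal value need no order between them: for the
  \<kappa> in use they are more than 2 apart.\<close>

function greedy_colour :: "'v set set \<Rightarrow> ('v \<Rightarrow> nat) \<Rightarrow> 'v \<Rightarrow> nat" where
  "greedy_colour E \<kappa> x = (LEAST a. a \<notin> greedy_colour E \<kappa> ` {y \<in> ball_r E x 2. \<kappa> y < \<kappa> x})"
  by auto
termination by (relation "Wellfounded.measure (\<lambda>(E, \<kappa>, x). \<kappa> x)") auto

declare greedy_colour.simps[simp del]

lemma greedy_colour_unused:
  assumes "finite (ball_r E x 2)"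
  shows "greedy_colour E \<kappa> x \<notin> greedy_colour E \<kappa> ` {y \<in> ball_r E x 2. \<kappa> y < \<kappa> x}"
proof -
  have "finite (greedy_colour E \<kappa> ` {y \<in> ball_r E x 2. \<kappa> y < \<kappa> x})" using assms by simp
  then have "\<exists>a. a \<notin> greedy_colour E \<kappa> ` {y \<in> ball_r E x 2. \<kappa> y < \<kappa> x}"
    by (rule ex_new_if_finite[OF infinite_UNIV_nat])
  then show ?thesis by (subst greedy_colour.simps) (rule LeastI_ex)
qed

lemma greedy_colour_least:
  assumes "b < greedy_colour E \<kappa> x"
  shows "b \<in> greedy_colour E \<kappa> ` {y \<in> ball_r E x 2. \<kappa> y < \<kappa> x}"
  using not_less_Least[of b "\<lambda>a. a \<notin> greedy_colour E \<kappa> ` {y \<in> ball_r E x 2. \<kappa> y < \<kappa> x}"] assms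
  unfolding greedy_colour.simps[of E \<kappa> x, symmetric] by blast

text \<open>Rewrites the recursion through the question whether some earlier vertex of the ball has
  colour \<open>b\<close>, a condition already known to be measurable when levels of \<kappa> are
  treated in order.\<close>

lemma greedy_colour_eq_iff:
  assumes "finite (ball_r E x 2)"
  shows "greedy_colour E \<kappa> x = a \<longleftrightarrow>
    (\<forall>b\<le>a. b = a \<longleftrightarrow> \<not> (\<exists>y\<in>ball_r E x 2. \<kappa> y < \<kappa> x \<and> greedy_colour E \<kappa> y = b))"
    (is "_ \<longleftrightarrow> ?R a")
proof -
  let ?U = "greedy_colour E \<kappa> ` {y \<in> ball_r E x 2. \<kappa> y < \<kappa> x}"
  have U: "b \<in> ?U \<longleftrightarrow> (\<exists>y\<in>ball_r E x 2. \<kappa> y < \<kappa> x \<and> greedy_colour E \<kappa> y = b)" for b by auto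
  have 1: "greedy_colour E \<kappa> x \<notin> ?U" by (rule greedy_colour_unused[OF assms])
  have 2: "b \<in> ?U" if "b < greedy_colour E \<kappa> x" for b by (rule greedy_colour_least[OF that])
  have "greedy_colour E \<kappa> x = a \<longleftrightarrow> (\<forall>b\<le>a. b = a \<longleftrightarrow> b \<notin> ?U)"
  proof
    assume R: "\<forall>b\<le>a. b = a \<longleftrightarrow> b \<notin> ?U"
    then have "a \<notin> ?U" by blast
    then have "\<not> a < greedy_colour E \<kappa> x" using 2 by blast
    moreover have "\<not> greedy_colour E \<kappa> x < a" using R 1 by (metis less_imp_le nat_neq_iff)
    ultimately show "greedy_colour E \<kappa> x = a" by simp
  qed (use 1 2 in \<open>metis le_neq_implies_less\<close>)
  then show ?thesis unfolding U .
qed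

text \<open>Every smaller colour is taken by a vertex of the ball other than \<open>x\<close>, hence
  the strict bound.\<close>

lemma greedy_colour_less:
  assumes "finite (ball_r E x 2)"
  shows "greedy_colour E \<kappa> x < card (ball_r E x 2)"
proof -
  let ?U = "greedy_colour E \<kappa> ` {y \<in> ball_r E x 2. \<kappa> y < \<kappa> x}"
  have "{..<greedy_colour E \<kappa> x} \<subseteq> ?U"
    using greedy_colour_least[of _ E \<kappa> x] by blast
  then have "greedy_colour E \<kappa> x \<le> card ?U"
    using card_mono[of ?U "{..<greedy_colour E \<kappa> x}"] assms by simp
  also have "\<dots> \<le> card {y \<in> ball_r E x 2. \<kappa> y < \<kappa> x}" using assms by (intro card_image_le) simp
  also have "\<dots> < card (ball_r E x 2)"
    using assms centre_in_ball_r[of x E 2] by (intro psubset_card_mono) auto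
  finally show ?thesis .
qed

text \<open>The vertex with the larger \<kappa>-value avoids the colour of the other.\<close>

lemma greedy_colour_proper:
  assumes fin: "\<And>x. finite (ball_r E x 2)"
    and proper: "\<And>x y. y \<in> ball_r E x 2 \<Longrightarrow> y \<noteq> x \<Longrightarrow> \<kappa> y \<noteq> \<kappa> x"
    and y: "y \<in> ball_r E x 2" "y \<noteq> x"
  shows "greedy_colour E \<kappa> y \<noteq> greedy_colour E \<kappa> x"
proof -
  consider "\<kappa> y < \<kappa> x" | "\<kappa> x < \<kappa> y" using proper[OF y] by linarith
  then show ?thesis
  proof cases
    case 1
    then show ?thesis using greedy_colour_unused[OF fin[of x], of \<kappa>] y
      by (metis (mono_tags, lifting) imageI mem_Collect_eq)
  next
    case 2
    then show ?thesis
      using greedy_colour_unused[OF fin[of y], of \<kappa>] ball_r_2_commute[OF y(1)]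
      by (metis (mono_tags, lifting) imageI mem_Collect_eq)
  qed
qed

section \<open>Vertex codes and their decoding\<close>

definition code_set :: "nat \<Rightarrow> nat \<Rightarrow> (nat \<times> (nat \<times> nat) set) set" where
  "code_set m k = {..<m} \<times> Pow ({..<m} \<times> {..<k})"

lemma finite_code_set: "finite (code_set m k)"
  by (simp add: code_set_def)

text \<open>A vertex code records the colour of the vertex and the pairs (colour of a neighbour, label of
  the edge towards it); an edge label is read off from the codes of its two ends.
  The fallback value \<open>k - 1\<close> keeps decoded labels below \<open>k\<close> for arbitrary codes.\<close>

definition decode :: "nat \<Rightarrow> nat \<Rightarrow> nat \<Rightarrow> nat \<Rightarrow> nat" where
  "decode m k a b = (let A = from_nat_into (code_set m k) a; B = from_nat_into (code_set m k) b in
     LEAST v. v = k - 1 \<or> (fst B, v) \<in> snd A \<and> (fst A, v) \<in> snd B)"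

lemma decode_commute: "decode m k a b = decode m k b a"
  unfolding decode_def Let_def by (intro arg_cong[where f = Least]) auto

lemma decode_less:
  assumes "k \<ge> 1"
  shows "decode m k a b < k"
proof -
  have "decode m k a b \<le> k - 1" unfolding decode_def Let_def by (intro Least_le) simp
  then show ?thesis using assms by linarith
qed

lemma decode_encoded:
  assumes "A \<in> code_set m k" "B \<in> code_set m k" "v < k"
    and "\<And>u. (fst B, u) \<in> snd A \<longleftrightarrow> u = v" "\<And>u. (fst A, u) \<in> snd B \<longleftrightarrow> u = v"
  shows "decode m k (to_nat_on (code_set m k) A) (to_nat_on (code_set m k) B) = v"
proof -
  have "countable (code_set m k)" by (intro countable_finite finite_code_set)
  then have "decode m k (to_nat_on (code_set m k) A) (to_nat_on (code_set m k) B)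
      = (LEAST u. u = k - 1 \<or> u = v)"
    using assms by (simp add: decode_def)
  \<comment> \<open>As v < k, the fallback k - 1 never undercuts the encoded label.\<close>
  also have "\<dots> = v" using assms(3) by (intro Least_equality) auto
  finally show ?thesis .
qed

context borel_graph
begin

text \<open>Induction over the values of \<kappa>: on the level set \<kappa> = n the colour depends
  only on colours at lower levels.\<close>

lemma greedy_colour_measurable:
  assumes [measurable]: "\<kappa> \<in> M \<rightarrow>\<^sub>M count_space UNIV"
  shows "greedy_colour E \<kappa> \<in> M \<rightarrow>\<^sub>M count_space UNIV"
proof -
  have stage: "Measurable.pred M (\<lambda>x. \<kappa> x = n \<and> greedy_colour E \<kappa> x = a)" for n a
  proof (induction n arbitrary: a rule: less_induct)
    case (less n)
    have [measurable]: "Measurable.pred M (\<lambda>x. \<kappa> (walk nbr w x) = m \<and> greedy_colour E \<kappa> (walk nbr w x) = b)"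
      if "m < n" for m b w
      by (rule measurable_compose[OF walk_measurable less[OF that]])
    \<comment> \<open>Naming the exact level m < n turns each piece into the induction hypothesis
      composed with a walk.\<close>
    have used: "Measurable.pred M (\<lambda>x. \<exists>w m. length w = 2 \<and> m < n \<and> \<kappa> (walk nbr w x) = m
        \<and> greedy_colour E \<kappa> (walk nbr w x) = b)" for b
    proof (intro pred_intros_countable)
      fix w m
      show "Measurable.pred M (\<lambda>x. length w = 2 \<and> m < n \<and> \<kappa> (walk nbr w x) = m
        \<and> greedy_colour E \<kappa> (walk nbr w x) = b)"
        by (cases "m < n"; cases "length w = 2") simp_all
    qed
    have eq: "(\<kappa> x = n \<and> greedy_colour E \<kappa> x = a) \<longleftrightarrow> \<kappa> x = n \<and> (\<forall>b\<in>{..a}. b = a \<longleftrightarrow>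
        \<not> (\<exists>w m. length w = 2 \<and> m < n \<and> \<kappa> (walk nbr w x) = m \<and> greedy_colour E \<kappa> (walk nbr w x) = b))"
      for x
    proof -
      have "(\<exists>y\<in>ball_r E x 2. \<kappa> y < n \<and> greedy_colour E \<kappa> y = b) \<longleftrightarrow> (\<exists>w m. length w = 2 \<and> m < n
          \<and> \<kappa> (walk nbr w x) = m \<and> greedy_colour E \<kappa> (walk nbr w x) = b)" for b
        unfolding ball_r_eq_walks by auto
      moreover have "greedy_colour E \<kappa> x = a \<longleftrightarrow> (\<forall>b\<in>{..a}. b = a \<longleftrightarrow>
          \<not> (\<exists>y\<in>ball_r E x 2. \<kappa> y < \<kappa> x \<and> greedy_colour E \<kappa> y = b))"
        using greedy_colour_eq_iff[OF finite_ball_r[of x 2], of \<kappa> a] by (simp only: Ball_def atMost_iff)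
      ultimately show ?thesis by metis
    qed
    note [measurable] = used
    show ?case unfolding eq by measurable
  qed
  have "Measurable.pred M (\<lambda>x. \<exists>n. \<kappa> x = n \<and> greedy_colour E \<kappa> x = a)" for a
    by (intro pred_intros_countable stage)
  then have "Measurable.pred M (\<lambda>x. greedy_colour E \<kappa> x = a)" for a by simp
  then show ?thesis
    by (intro measurable_count_space_eq2_countable[THEN iffD2])
       (auto simp: pred_def vimage_def Int_def conj_commute)
qed

text \<open>\<open>(d + 1)\<^sup>2\<close> bounds the 2-balls and hence the greedy colours, so the
  number of codes depends on d and k only, whatever the graph and the labelling.\<close>

lemma edge_labelling_encoding:
  fixes \<kappa> :: "'a \<Rightarrow> nat" and F :: "'a set \<Rightarrow> nat"
  assumes \<kappa>[measurable]: "\<kappa> \<in> M \<rightarrow>\<^sub>M count_space UNIV"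
    and proper: "\<And>x y. y \<in> ball_r E x 2 \<Longrightarrow> y \<noteq> x \<Longrightarrow> \<kappa> y \<noteq> \<kappa> x"
    and F: "\<And>e. e \<in> E \<Longrightarrow> F e < k"
    and F_meas: "\<And>i. i < k \<Longrightarrow> borel_edges M {e \<in> E. F e = i}"
  defines "C \<equiv> code_set ((d + 1)\<^sup>2) k"
  shows "\<exists>c. c \<in> M \<rightarrow>\<^sub>M count_space UNIV \<and> (\<forall>x. c x < card C)
     \<and> (\<forall>x y. adj E x y \<longrightarrow> decode ((d + 1)\<^sup>2) k (c x) (c y) = F {x, y})"
proof -
  define col where "col = greedy_colour E \<kappa>"
  have col_meas[measurable]: "col \<in> M \<rightarrow>\<^sub>M count_space UNIV"
    unfolding col_def by (rule greedy_colour_measurable[OF \<kappa>])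
  have col_less: "col x < (d + 1)\<^sup>2" for x
    unfolding col_def
    by (rule less_le_trans[OF greedy_colour_less[OF finite_ball_r] card_ball_r])
  have col_proper: "col y \<noteq> col x" if "y \<in> ball_r E x 2" "y \<noteq> x" for x y
    unfolding col_def by (rule greedy_colour_proper[OF finite_ball_r proper that])
  \<comment> \<open>Two neighbours of \<open>x\<close> are joined by a path of length 2 through
    \<open>x\<close>; this is where distance 2 is used.\<close>
  have nbr_col_inj: "y = y'" if "adj E x y" "adj E x y'" "col y = col y'" for x y y'
  proof (rule ccontr)
    assume "y \<noteq> y'"
    have "y' \<in> ball_r E y 2"
      using that by (auto simp: numeral_2_eq_2 ball_r_Suc ball_r_0 adj_commute)
    then show False using col_proper[of y' y] \<open>y \<noteq> y'\<close> that(3) by auto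
  qed
  define s where "s x = {(col y, F {x, y}) | y. adj E x y}" for x
  define p where "p x = (col x, s x)" for x
  have adjE: "{x, y} \<in> E" if "adj E x y" for x y using that by (simp add: adj_def)
  have p_in: "p x \<in> C" for x
    using col_less F adjE by (auto simp: p_def s_def C_def code_set_def)
  have lab[measurable]: "Measurable.pred M (\<lambda>x. adj E x (nbr i x) \<and> F {x, nbr i x} = v)"
    if "v < k" for i v
  proof -
    have "{(x, y). {x, y} \<in> {e \<in> E. F e = v} \<and> x \<noteq> y} \<in> sets (M \<Otimes>\<^sub>M M)"
      using F_meas[OF that] unfolding borel_edges_def by blast
    moreover have "(\<lambda>x. (x, nbr i x)) \<in> M \<rightarrow>\<^sub>M M \<Otimes>\<^sub>M M"
      using nbr_measurable by measurable
    ultimately show ?thesis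
      using measurable_sets[of "\<lambda>x. (x, nbr i x)" M "M \<Otimes>\<^sub>M M"]
      by (fastforce simp: pred_def vimage_def adj_def space_UNIV conj_ac)
  qed
  have mem_s: "(b, v) \<in> s x \<longleftrightarrow> (\<exists>i. col (nbr i x) = b \<and> adj E x (nbr i x) \<and> F {x, nbr i x} = v)"
    for b v x
  proof
    assume "(b, v) \<in> s x"
    then obtain y where y: "b = col y" "v = F {x, y}" "adj E x y" by (auto simp: s_def)
    then have "y \<in> range (\<lambda>i. nbr i x)" unfolding range_nbr by simp
    then show "\<exists>i. col (nbr i x) = b \<and> adj E x (nbr i x) \<and> F {x, nbr i x} = v" using y by auto
  qed (auto simp: s_def)
  have mem_s_meas: "Measurable.pred M (\<lambda>x. (b, v) \<in> s x)" if "v < k" for b v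
  proof -
    note [measurable] = nbr_measurable lab[OF that]
    show ?thesis unfolding mem_s by measurable
  qed
  have p_meas: "p \<in> M \<rightarrow>\<^sub>M count_space C"
  proof (rule measurable_count_space_eq2[THEN iffD2])
    show "finite C" by (simp add: C_def finite_code_set)
    show "p \<in> space M \<rightarrow> C \<and> (\<forall>a\<in>C. p -` {a} \<inter> space M \<in> sets M)"
    proof (intro conjI ballI)
      fix a assume "a \<in> C"
      then obtain b T where a: "a = (b, T)" and T: "T \<subseteq> {..<(d + 1)\<^sup>2} \<times> {..<k}"
        by (auto simp: C_def code_set_def)
      have sub: "s x \<subseteq> {..<(d + 1)\<^sup>2} \<times> {..<k}" for x
        using p_in[of x] by (auto simp: p_def C_def code_set_def)
      have eq: "p x = a \<longleftrightarrow> col x = b \<and>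
          (\<forall>q\<in>{..<(d + 1)\<^sup>2} \<times> {..<k}. q \<in> s x \<longleftrightarrow> q \<in> T)" for x
        using T sub[of x] unfolding p_def a by blast
      have "Measurable.pred M (\<lambda>x. \<forall>q\<in>{..<(d + 1)\<^sup>2} \<times> {..<k}. q \<in> s x \<longleftrightarrow> q \<in> T)"
      proof (rule pred_intros_finite)
        fix q assume "q \<in> {..<(d + 1)\<^sup>2} \<times> {..<k}"
        then have [measurable]: "Measurable.pred M (\<lambda>x. q \<in> s x)"
          using mem_s_meas[of "snd q" "fst q"] by auto
        show "Measurable.pred M (\<lambda>x. q \<in> s x \<longleftrightarrow> q \<in> T)" by measurable
      qed simp
      then have "Measurable.pred M (\<lambda>x. p x = a)" unfolding eq by measurable
      then show "p -` {a} \<inter> space M \<in> sets M"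
        by (simp add: pred_def vimage_def Int_def conj_commute)
    qed (use p_in in auto)
  qed
  define c where "c x = to_nat_on C (p x)" for x
  have "c \<in> M \<rightarrow>\<^sub>M count_space UNIV"
    unfolding c_def by (rule measurable_compose[OF p_meas]) simp
  moreover have "c x < card C" for x
    using bij_betwE[OF to_nat_on_finite[of C]] p_in[of x]
    by (auto simp: c_def C_def finite_code_set)
  moreover have "decode ((d + 1)\<^sup>2) k (c x) (c y) = F {x, y}" if xy: "adj E x y" for x y
    unfolding c_def C_def
  proof (rule decode_encoded)
    show "p x \<in> code_set ((d + 1)\<^sup>2) k" "p y \<in> code_set ((d + 1)\<^sup>2) k"
      using p_in by (auto simp: C_def)
    show "F {x, y} < k" using F adjE[OF xy] by blast
    show "(fst (p y), u) \<in> snd (p x) \<longleftrightarrow> u = F {x, y}" for u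
      using nbr_col_inj[of x _ y] xy by (auto simp: p_def s_def)
    show "(fst (p x), u) \<in> snd (p y) \<longleftrightarrow> u = F {x, y}" for u
      using nbr_col_inj[of y _ x] xy adj_commute[of E]
      by (auto simp: p_def s_def insert_commute)
  qed
  ultimately show ?thesis by blast
qed

lemma edge_filter_eq_labelled:
  assumes "\<And>x y. adj E x y \<Longrightarrow> \<phi> (c x) (c y) = F {x, y}"
  shows "{e \<in> E. F e \<in> S} = edge_filter E c \<phi> S"
proof (intro equalityI subsetI)
  fix e assume e: "e \<in> {e \<in> E. F e \<in> S}"
  then obtain x y where xy: "x \<noteq> y" "e = {x, y}" using edge_doubleton[of e] by auto
  then have "\<phi> (c x) (c y) \<in> S" using e assms[of x y] by (simp add: adj_def)
  then show "e \<in> edge_filter E c \<phi> S"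
    unfolding edge_filter_def using e xy by (intro CollectI conjI exI[of _ x] exI[of _ y]) auto
next
  fix e assume "e \<in> edge_filter E c \<phi> S"
  then obtain u v where "e \<in> E" "e = {u, v}" "u \<noteq> v" "\<phi> (c u) (c v) \<in> S"
    by (auto simp: edge_filter_def)
  then show "e \<in> {e \<in> E. F e \<in> S}" using assms[of u v] by (simp add: adj_def)
qed

lemma vertex_colouring_induces_labelling:
  assumes [measurable]: "c \<in> M \<rightarrow>\<^sub>M count_space UNIV" and sym: "\<And>a b :: nat. \<phi> a b = \<phi> b a"
    and less: "\<And>a b. \<phi> a b < k"
  shows "(\<lambda>S. \<psi> (edge_filter E c \<phi> S)) \<in> quotients_gr M E \<psi> k"
proof -
  \<comment> \<open>\<open>SOME\<close> picks an orientation of the edge; by symmetry of \<phi> the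
    label does not depend on it.\<close>
  define F where "F e = (let p = SOME p. e = {fst p, snd p} in \<phi> (c (fst p)) (c (snd p)))" for e
  have F_eq: "F {x, y} = \<phi> (c x) (c y)" for x y
  proof -
    define p where "p = (SOME p. {x, y} = {fst p, snd p})"
    have "{x, y} = {fst p, snd p}"
      unfolding p_def by (rule someI[of _ "(x, y)"]) simp
    then show ?thesis unfolding F_def p_def[symmetric] Let_def
      using sym by (auto simp: doubleton_eq_iff)
  qed
  have flt: "{e \<in> E. F e \<in> S} = edge_filter E c \<phi> S" for S
    by (rule edge_filter_eq_labelled) (simp add: F_eq)
  have "F e < k" for e by (simp add: F_def Let_def less)
  moreover have "borel_edges M {e \<in> E. F e = i}" for i
    unfolding borel_edges_def
  proof
    show "\<forall>e\<in>{e \<in> E. F e = i}. \<exists>x y. x \<noteq> y \<and> e = {x, y}" by (simp add: edge_doubleton)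
    have 1: "Measurable.pred (M \<Otimes>\<^sub>M M) (\<lambda>p. adj E (fst p) (snd p))"
      by (rule pred_adj; measurable)
    have 2: "Measurable.pred (M \<Otimes>\<^sub>M M) (\<lambda>p. \<phi> (c (fst p)) (c (snd p)) = i)" by measurable
    have "Measurable.pred (M \<Otimes>\<^sub>M M) (\<lambda>p. adj E (fst p) (snd p) \<and> \<phi> (c (fst p)) (c (snd p)) = i)"
      using 1 2 by measurable
    moreover have "{(x, y). {x, y} \<in> {e \<in> E. F e = i} \<and> x \<noteq> y}
        = {p \<in> space (M \<Otimes>\<^sub>M M). adj E (fst p) (snd p) \<and> \<phi> (c (fst p)) (c (snd p)) = i}"
      by (auto simp: adj_def F_eq space_pair_measure space_UNIV)
    ultimately show "{(x, y). {x, y} \<in> {e \<in> E. F e = i} \<and> x \<noteq> y} \<in> sets (M \<Otimes>\<^sub>M M)"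
      by (simp add: pred_def)
  qed
  ultimately show ?thesis
    unfolding quotients_gr_def using flt by (intro CollectI exI[of _ F]) auto
qed

lemma P_gr_bounds: "0 \<le> P_gr M E r c B" "P_gr M E r c B \<le> 1"
  by (simp_all add: P_gr_def)

end

text \<open>The bounds 0 and 1 keep the set under the supremum bounded above, so that the supremum
  dominates each single difference.\<close>

lemma dist_P_bound:
  assumes "\<And>B. 0 \<le> p B \<and> p B \<le> 1" "\<And>B. 0 \<le> q B \<and> q B \<le> 1" "dist_P p q < \<delta>"
  shows "\<bar>p B - q B\<bar> \<le> \<delta>"
proof -
  have "\<bar>p B - q B\<bar> \<le> 1" for B using assms(1,2)[of B] by (simp add: abs_le_iff)
  then have "bdd_above (range (\<lambda>B. \<bar>p B - q B\<bar>))" by (intro bdd_aboveI[of _ 1]) auto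
  then have "\<bar>p B - q B\<bar> \<le> dist_P p q" unfolding dist_P_def by (intro cSUP_upper) auto
  then show ?thesis using assms(3) by simp
qed

lemma dist_P_commute: "dist_P p q = dist_P q p"
  by (simp add: dist_P_def abs_minus_commute)

lemma dist_quot_commute: "dist_quot k p q = dist_quot k q p"
  by (simp add: dist_quot_def abs_minus_commute)

lemma dist_quot_less_iff: "dist_quot k p q < \<epsilon> \<longleftrightarrow> (\<forall>S\<subseteq>{..<k}. \<bar>p S - q S\<bar> < \<epsilon>)"
  unfolding dist_quot_def by (subst Max_less_iff) auto

text \<open>Encode the labelling of the first graph as a colouring, match its ball statistics by a
  colouring of the second graph, and decode that one; decoding accepts any colouring, so \<kappa>
  lives on the first graph. The two rank approximations cost 1 / r each, the difference of the
  statistics the remaining term of the bound on \<epsilon>.\<close>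

proposition quotient_transfer:
  fixes \<kappa> :: "'a \<Rightarrow> nat"
  assumes "borel_graph M1 E1 nbr1 d" "borel_graph M2 E2 nbr2 d"
    and \<kappa>: "\<kappa> \<in> M1 \<rightarrow>\<^sub>M count_space UNIV"
      "\<And>x y. y \<in> ball_r E1 x 2 \<Longrightarrow> y \<noteq> x \<Longrightarrow> \<kappa> y \<noteq> \<kappa> x"
    and "k \<ge> 1" "r > 0" and K: "K = card (code_set ((d + 1)\<^sup>2) k)"
    and close: "\<And>p. p \<in> Q_gr M1 E1 K r \<Longrightarrow> \<exists>q\<in>Q_gr M2 E2 K r. dist_P p q < \<delta>"
    and \<epsilon>: "2 / real r + real (card (bounded_reps ((d + 1) ^ r) K)) * \<delta> < \<epsilon>"
    and p: "p \<in> quotients_gr M1 E1 (graphing_rank M1) k"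
  shows "\<exists>q\<in>quotients_gr M2 E2 (graphing_rank M2) k. dist_quot k p q < \<epsilon>"
proof -
  interpret G1: borel_graph M1 E1 nbr1 d by fact
  interpret G2: borel_graph M2 E2 nbr2 d by fact
  let ?\<phi> = "decode ((d + 1)\<^sup>2) k" and ?\<R> = "bounded_reps ((d + 1) ^ r) K"
  obtain F where F: "p = (\<lambda>S. graphing_rank M1 {e \<in> E1. F e \<in> S})" "\<And>e. e \<in> E1 \<Longrightarrow> F e < k"
      "\<And>i. i < k \<Longrightarrow> borel_edges M1 {e \<in> E1. F e = i}"
    using p unfolding quotients_gr_def by auto
  obtain c where c: "c \<in> M1 \<rightarrow>\<^sub>M count_space UNIV" "\<And>x. c x < K"
      "\<And>x y. adj E1 x y \<Longrightarrow> ?\<phi> (c x) (c y) = F {x, y}"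
    using G1.edge_labelling_encoding[OF \<kappa> F(2,3)] unfolding K by blast
  have "P_gr M1 E1 r c \<in> Q_gr M1 E1 K r" unfolding Q_gr_def using c by blast
  then obtain c' where c': "c' \<in> M2 \<rightarrow>\<^sub>M count_space UNIV" "\<And>x. c' x < K"
      "dist_P (P_gr M1 E1 r c) (P_gr M2 E2 r c') < \<delta>"
    using close[of "P_gr M1 E1 r c"] unfolding Q_gr_def G2.space_UNIV by blast
  have PP: "\<bar>P_gr M1 E1 r c B - P_gr M2 E2 r c' B\<bar> \<le> \<delta>" for B
    by (rule dist_P_bound[OF _ _ c'(3)]) (simp_all add: G1.P_gr_bounds G2.P_gr_bounds)
  define q where "q = (\<lambda>S. graphing_rank M2 (edge_filter E2 c' ?\<phi> S))"
  have "q \<in> quotients_gr M2 E2 (graphing_rank M2) k"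
    unfolding q_def
    by (rule G2.vertex_colouring_induces_labelling[OF c'(1) decode_commute decode_less[OF \<open>k \<ge> 1\<close>]])
  moreover have "\<bar>p S - q S\<bar> < \<epsilon>" for S
  proof -
    have "p S = graphing_rank M1 (edge_filter E1 c ?\<phi> S)"
      using G1.edge_filter_eq_labelled[of ?\<phi> c F S] c(3) F(1) by simp
    moreover have "\<bar>1 - graphing_rank M1 (edge_filter E1 c ?\<phi> S)
        - ball_estimate ?\<phi> S r ?\<R> (P_gr M1 E1 r c)\<bar> \<le> 1 / real r"
      by (rule G1.graphing_rank_approx[OF c(1,2) decode_commute \<open>r > 0\<close>])
    moreover have "\<bar>1 - q S - ball_estimate ?\<phi> S r ?\<R> (P_gr M2 E2 r c')\<bar> \<le> 1 / real r"
      unfolding q_def by (rule G2.graphing_rank_approx[OF c'(1,2) decode_commute \<open>r > 0\<close>])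
    moreover have "\<bar>ball_estimate ?\<phi> S r ?\<R> (P_gr M1 E1 r c) - ball_estimate ?\<phi> S r ?\<R> (P_gr M2 E2 r c')\<bar>
        \<le> real (card ?\<R>) * \<delta>"
      by (rule ball_estimate_lipschitz) (rule PP)
    ultimately show ?thesis using \<epsilon> by linarith
  qed
  ultimately show ?thesis unfolding dist_quot_less_iff by blast
qed

section \<open>Graphings and finite graphs as Borel graphs\<close>

lemma graphing_is_borel_graph:
  fixes M :: "'a::polish_space measure"
  assumes "graphing M E"
  shows "\<exists>b. \<forall>d\<ge>b. \<exists>nbr. borel_graph M E nbr d"
proof -
  have M: "prob_space M" "sets M = sets borel"
    and E: "\<And>e. e \<in> E \<Longrightarrow> \<exists>x y. x \<noteq> y \<and> e = {x, y}"
      "{(x, y). {x, y} \<in> E \<and> x \<noteq> y} \<in> sets (M \<Otimes>\<^sub>M M)"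
    using assms by (auto simp: graphing_def borel_edges_def)
  obtain b where "\<forall>x. deg_to E UNIV x \<le> b \<and> finite {y. adj E x y}"
    using assms unfolding graphing_def by blast
  then have b: "\<And>x. card {y. adj E x y} \<le> b" "\<And>x. finite {y. adj E x y}"
    by (simp_all add: deg_to_def)
  have MM: "sets (M \<Otimes>\<^sub>M M) = sets borel"
    using sets_pair_measure_cong[OF M(2) M(2)] unfolding borel_prod .
  have "{(x, y). {x, y} \<in> E \<and> x \<noteq> y} = {p. adj E (fst p) (snd p)}" by (auto simp: adj_def)
  then have adj: "{p. adj E (fst p) (snd p)} \<in> sets (M \<Otimes>\<^sub>M M)" using E(2) by simp
  have "\<exists>D g. (\<forall>i::nat. D i \<in> sets borel \<and> g i \<in> borel_measurable borel)
      \<and> (\<forall>x y. (x, y) \<in> {p. adj E (fst p) (snd p)} \<longleftrightarrow> (\<exists>i. x \<in> D i \<and> y = g i x))"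
    by (rule bounded_sections_selectors[of _ b]) (use adj b MM in simp_all)
  then obtain D g where Dg: "\<forall>i::nat. D i \<in> sets borel \<and> g i \<in> borel_measurable borel"
      "\<forall>x y. (x, y) \<in> {p. adj E (fst p) (snd p)} \<longleftrightarrow> (\<exists>i. x \<in> D i \<and> y = g i x)"
    by (elim exE conjE)
  have D: "D i \<in> sets borel" and g: "g i \<in> borel_measurable borel" for i using Dg(1) by auto
  have adj_iff: "adj E x y \<longleftrightarrow> (\<exists>i. x \<in> D i \<and> y = g i x)" for x y using Dg(2) by simp
  \<comment> \<open>Off its domain a selector is replaced by staying put, and index 0 of
    \<open>nbr'\<close> is the identity, so \<open>x\<close> always occurs in the range.\<close>
  define nbr where "nbr i x = (if x \<in> D i then g i x else x)" for i x
  define nbr' where "nbr' = case_nat (\<lambda>x. x) nbr"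
  have nbr_meas: "nbr i \<in> M \<rightarrow>\<^sub>M M" for i
  proof -
    note [measurable] = D[of i] g[of i]
    have "nbr i \<in> borel_measurable borel" unfolding nbr_def by measurable
    then show ?thesis using measurable_cong_sets[OF M(2) M(2)] by blast
  qed
  have range: "range (\<lambda>i. nbr' i x) = insert x {y. adj E x y}" for x
  proof
    show "range (\<lambda>i. nbr' i x) \<subseteq> insert x {y. adj E x y}"
      by (auto simp: nbr'_def nbr_def adj_iff split: nat.splits)
    have "x \<in> range (\<lambda>i. nbr' i x)" by (rule range_eqI[of _ _ 0]) (simp add: nbr'_def)
    moreover have "y \<in> range (\<lambda>i. nbr' i x)" if xy: "adj E x y" for y
    proof -
      obtain i where "x \<in> D i" "y = g i x" using xy adj_iff by blast
      then show ?thesis by (intro range_eqI[of _ _ "Suc i"]) (simp add: nbr'_def nbr_def)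
    qed
    ultimately show "insert x {y. adj E x y} \<subseteq> range (\<lambda>i. nbr' i x)" by blast
  qed
  have "borel_graph M E nbr' d" if "d \<ge> b" for d
  proof (intro borel_graph.intro M(1) borel_graph_axioms.intro)
    show "space M = UNIV" using sets_eq_imp_space_eq[OF M(2)] by simp
    show "\<exists>x y. x \<noteq> y \<and> e = {x, y}" if "e \<in> E" for e using E(1)[OF that] .
    show "{p. fst p = snd p} \<in> sets (M \<Otimes>\<^sub>M M)"
      unfolding MM by (intro borel_closed closed_Collect_eq continuous_intros)
    show "nbr' i \<in> M \<rightarrow>\<^sub>M M" for i by (cases i) (simp_all add: nbr'_def nbr_meas)
    show "card {y. adj E x y} \<le> d" for x using b(1)[of x] that by simp
  qed (use adj range b in auto)
  then show ?thesis by blast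
qed

text \<open>The 2-ball is finite, so some basic open set contains \<open>x\<close> and no other
  vertex of it; the least index of such a set is the colour. Two vertices within distance 2 with one
  index would both lie in a set isolating each from the other.\<close>

lemma countable_distance_2_colouring:
  fixes M :: "'a::{second_countable_topology, t1_space} measure"
  assumes "borel_graph M E nbr d" and M: "sets M = sets borel"
  shows "\<exists>\<kappa> :: 'a \<Rightarrow> nat. \<kappa> \<in> M \<rightarrow>\<^sub>M count_space UNIV
           \<and> (\<forall>x y. y \<in> ball_r E x 2 \<longrightarrow> y \<noteq> x \<longrightarrow> \<kappa> y \<noteq> \<kappa> x)"
proof -
  interpret borel_graph M E nbr d by fact
  obtain U :: "nat \<Rightarrow> 'a set" where U_open: "\<And>i. open (U i)"
    and U_basis: "\<And>W x. open W \<Longrightarrow> x \<in> W \<Longrightarrow> \<exists>i. x \<in> U i \<and> U i \<subseteq> W"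
    using open_basis_sequence_exists by blast
  have U_sets[measurable]: "U i \<in> sets M" for i
    unfolding M using U_open by simp
  define P where "P i x \<longleftrightarrow> x \<in> U i \<and> (\<forall>y\<in>ball_r E x 2. y \<noteq> x \<longrightarrow> y \<notin> U i)" for i x
  have P_meas[measurable]: "Measurable.pred M (P i)" for i
  proof -
    have eq: "P i x \<longleftrightarrow> x \<in> U i \<and> (\<forall>w. length w = 2 \<longrightarrow>
        \<not> walk nbr w x = walk nbr [] x \<longrightarrow> \<not> walk nbr w x \<in> U i)" for x
      unfolding P_def ball_r_eq_walks by auto
    have [measurable]: "Measurable.pred M (\<lambda>x. walk nbr w x = walk nbr w' x)" for w w'
      by (intro pred_vertex_eq walk_measurable)
    show ?thesis unfolding eq[abs_def] by measurable
  qed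
  define \<kappa> where "\<kappa> x = (LEAST i. P i x)" for x
  have "\<exists>i. P i x" for x
  proof -
    have "open (- (ball_r E x 2 - {x}))"
      by (intro open_Compl finite_imp_closed finite_Diff finite_ball_r)
    then obtain i where "x \<in> U i" "U i \<subseteq> - (ball_r E x 2 - {x})"
      using U_basis[of "- (ball_r E x 2 - {x})" x] by auto
    then show ?thesis by (intro exI[of _ i]) (auto simp: P_def)
  qed
  then have P\<kappa>: "P (\<kappa> x) x" for x unfolding \<kappa>_def by (rule LeastI_ex)
  have "\<kappa> \<in> M \<rightarrow>\<^sub>M count_space UNIV" unfolding \<kappa>_def by measurable
  moreover have "\<kappa> y \<noteq> \<kappa> x" if "y \<in> ball_r E x 2" "y \<noteq> x" for x y
    using P\<kappa>[of x] P\<kappa>[of y] that by (auto simp: P_def)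
  ultimately show ?thesis by blast
qed

section \<open>Finite graphs with the uniform measure on their vertices\<close>

context
  fixes D :: nat and V :: "nat set" and E :: "nat set set"
  assumes fg: "finite_graph D V E"
begin

lemma finite_graph_finite: "finite V" "V \<noteq> {}"
  using fg by (auto simp: finite_graph_def)

lemma finite_graph_edge_doubleton:
  assumes "e \<in> E"
  shows "\<exists>x y. x \<noteq> y \<and> e = {x, y}"
proof -
  have "card e = 2" using assms fg by (simp add: finite_graph_def)
  then show ?thesis unfolding card_2_iff by blast
qed

lemma finite_graph_adj:
  assumes "adj E x y"
  shows "x \<in> V" "y \<in> V"
  using assms fg by (auto simp: finite_graph_def adj_def)

lemma finite_graph_component_subset:
  assumes "F \<subseteq> E" "x \<in> V"
  shows "component F x \<subseteq> V"
proof
  fix y assume "y \<in> component F x"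
  then have "(x, y) \<in> (adj_rel F)\<^sup>*" by (simp add: component_def)
  then show "y \<in> V"
  proof induction
    case (step y z)
    then have "adj E y z" using assms(1) by (auto simp: adj_rel_def adj_def)
    then show ?case using finite_graph_adj by blast
  qed (rule assms(2))
qed

text \<open>The measure lives on all naturals: those outside \<open>V\<close> are isolated vertices
  of measure zero.\<close>

abbreviation (input) "\<mu> \<equiv> measure_pmf (pmf_of_set V)"

lemma finite_graph_sets_pair: "sets (\<mu> \<Otimes>\<^sub>M \<mu>) = UNIV"
proof -
  have "sets (\<mu> \<Otimes>\<^sub>M \<mu>) = sets (count_space UNIV \<Otimes>\<^sub>M count_space UNIV :: (nat \<times> nat) measure)"
    by (intro sets_pair_measure_cong) simp_all
  also have "\<dots> = UNIV" by (subst pair_measure_countable) auto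
  finally show ?thesis .
qed

lemma finite_graph_is_borel_graph:
  assumes "D \<le> d"
  shows "borel_graph \<mu> E (\<lambda>i x. if adj E x i then i else x) d"
proof (intro borel_graph.intro measure_pmf.prob_space_axioms borel_graph_axioms.intro)
  show "\<exists>x y. x \<noteq> y \<and> e = {x, y}" if "e \<in> E" for e
    by (rule finite_graph_edge_doubleton[OF that])
  have sub: "{y. adj E x y} \<subseteq> V" for x using finite_graph_adj by blast
  show "finite {y. adj E x y}" for x by (rule finite_subset[OF sub finite_graph_finite(1)])
  show "card {y. adj E x y} \<le> d" for x
  proof (cases "x \<in> V")
    case True
    have "{y. adj E x y} = {y \<in> V. adj E x y}" using sub by auto
    then show ?thesis using True fg assms by (force simp: finite_graph_def deg_to_def)
  next
    case False
    then have "{y. adj E x y} = {}" using finite_graph_adj by blast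
    then show ?thesis by (simp only: card.empty)
  qed
  show "range (\<lambda>i. if adj E x i then i else x) = insert x {y. adj E x y}" for x
  proof -
    have "x \<in> range (\<lambda>i. if adj E x i then i else x)"
      by (rule range_eqI[of _ _ x]) (simp add: adj_def)
    moreover have "y \<in> range (\<lambda>i. if adj E x i then i else x)" if "adj E x y" for y
      by (rule range_eqI[of _ _ y]) (simp add: that)
    ultimately show ?thesis by auto
  qed
qed (simp_all add: finite_graph_sets_pair)

lemma finite_graph_ball_iso_cong:
  assumes "x \<in> V" "\<And>v. v \<in> V \<Longrightarrow> c v = c' v"
  shows "ball_iso E c r x B \<longleftrightarrow> ball_iso E c' r x B"
proof -
  obtain n Eb col where B: "B = (n, Eb, col)" by (cases B)
  have "ball_r E x r \<subseteq> V"
    using finite_graph_component_subset[OF order_refl assms(1)] by (auto simp: component_eq_UN_ball_r)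
  then have "c (f i) = c' (f i)" if "bij_betw f {..<n} (ball_r E x r)" "i < n" for f i
    using assms(2) that by (auto simp: bij_betw_def)
  then show ?thesis unfolding ball_iso_def B prod.case by (intro ex_cong1) auto
qed

lemma P_fin_eq_P_gr: "P_fin V E r c = P_gr \<mu> E r c"
proof
  fix B
  have "V \<inter> {x. ball_iso E c r x B} = {x \<in> V. ball_iso E c r x B}" by auto
  then show "P_fin V E r c B = P_gr \<mu> E r c B"
    using finite_graph_finite by (simp add: P_fin_def P_gr_def measure_pmf_of_set)
qed

text \<open>The two sides bound colours on \<open>V\<close> and on all naturals respectively.
  Resetting colours outside \<open>V\<close> to 0, a legal colour as k is positive, affects no ball
  around a vertex of \<open>V\<close>.\<close>

lemma Q_fin_eq_Q_gr:
  assumes "k \<ge> 1"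
  shows "Q_fin V E k r = Q_gr \<mu> E k r"
proof (intro equalityI subsetI)
  fix p assume "p \<in> Q_fin V E k r"
  then obtain c where c: "p = P_fin V E r c" "\<And>v. v \<in> V \<Longrightarrow> c v < k" by (auto simp: Q_fin_def)
  define c' where "c' x = (if x \<in> V then c x else 0)" for x
  have "{x \<in> V. ball_iso E c r x B} = {x \<in> V. ball_iso E c' r x B}" for B
    by (intro Collect_cong conj_cong refl finite_graph_ball_iso_cong) (simp_all add: c'_def)
  then have "p = P_gr \<mu> E r c'"
    unfolding c(1) P_fin_eq_P_gr[symmetric] by (intro ext) (simp add: P_fin_def)
  moreover have "c' x < k" for x using c(2) assms by (auto simp: c'_def)
  ultimately show "p \<in> Q_gr \<mu> E k r" unfolding Q_gr_def by auto
next
  fix p assume "p \<in> Q_gr \<mu> E k r"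
  then show "p \<in> Q_fin V E k r" unfolding Q_gr_def Q_fin_def P_fin_eq_P_gr by auto
qed

text \<open>Grouped by components, each component contributes its size times the reciprocal of its
  size.\<close>

lemma sum_inverse_card_component:
  assumes "F \<subseteq> E"
  shows "(\<Sum>x\<in>V. 1 / real (card (component F x))) = real (card (component F ` V))"
proof -
  have sym: "sym ((adj_rel F)\<^sup>*)"
    by (intro sym_rtrancl symI) (auto simp: adj_rel_def adj_commute)
  have "(\<Sum>x\<in>V. 1 / real (card (component F x)))
      = (\<Sum>C\<in>component F ` V. \<Sum>x\<in>{x \<in> V. component F x = C}. 1 / real (card (component F x)))"
    by (rule sum.image_gen[OF finite_graph_finite(1)])
  also have "\<dots> = (\<Sum>C\<in>component F ` V. 1)"
  proof (rule sum.cong[OF refl])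
    fix C assume "C \<in> component F ` V"
    then obtain z where z: "z \<in> V" "C = component F z" by blast
    have CV: "C \<subseteq> V" using finite_graph_component_subset[OF assms z(1)] z(2) by simp
    have mem: "x \<in> component F x" for x by (simp add: component_def)
    have "component F x = C" if "x \<in> C" for x
      using that sym unfolding z(2) component_def by (auto dest: symD intro: rtrancl_trans)
    then have "{x \<in> V. component F x = C} = C" using CV mem by blast
    moreover have "finite C" "C \<noteq> {}"
      using finite_subset[OF CV finite_graph_finite(1)] mem z by auto
    ultimately show "(\<Sum>x\<in>{x \<in> V. component F x = C}. 1 / real (card (component F x))) = 1"
      using \<open>\<And>x. x \<in> C \<Longrightarrow> component F x = C\<close> by simp
  qed
  finally show ?thesis by simp
qed

lemma graph_rank_eq_graphing_rank:
  assumes "F \<subseteq> E"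
  shows "graph_rank V F / real (card V) = graphing_rank \<mu> F"
proof -
  have "real (card V) \<noteq> 0" using finite_graph_finite by simp
  moreover have "(\<integral>x. 1 / real (card (component F x)) \<partial>\<mu>) = real (card (component F ` V)) / real (card V)"
    using finite_graph_finite
    by (simp add: integral_pmf_of_set sum_inverse_card_component[OF assms])
  ultimately show ?thesis by (simp add: graph_rank_def graphing_rank_def diff_divide_distrib)
qed

lemma quotients_fin_eq_quotients_gr:
  "quotients_fin E (\<lambda>F. graph_rank V F / real (card V)) k = quotients_gr \<mu> E (graphing_rank \<mu>) k"
proof -
  have "borel_edges \<mu> {e \<in> E. F e = i}" for F :: "nat set \<Rightarrow> nat" and i
    using finite_graph_edge_doubleton by (simp add: borel_edges_def finite_graph_sets_pair)
  moreover have "graph_rank V {e \<in> E. F e \<in> S} / real (card V) = graphing_rank \<mu> {e \<in> E. F e \<in> S}"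
    for F :: "nat set \<Rightarrow> nat" and S
    by (rule graph_rank_eq_graphing_rank) auto
  ultimately show ?thesis unfolding quotients_fin_def quotients_gr_def by simp
qed

end

theorem theorem1p1:
  fixes D :: nat
    and Vs :: "nat \<Rightarrow> nat set" and Es :: "nat \<Rightarrow> nat set set"
    and M :: "'a::polish_space measure" and E :: "'a set set"
  assumes "D \<ge> 1"
    and "\<And>n. finite_graph D (Vs n) (Es n)"
    and "graphing M E"
    and "local_global_conv Vs Es M E"
  shows "\<forall>k\<ge>1. hausdorff_conv (dist_quot k)
           (\<lambda>n. quotients_fin (Es n) (\<lambda>F. graph_rank (Vs n) F / real (card (Vs n))) k)
           (quotients_gr M E (graphing_rank M) k)"
proof (intro allI impI)
  fix k :: nat assume k: "k \<ge> 1"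
  obtain b where b: "\<And>d. d \<ge> b \<Longrightarrow> \<exists>nbr. borel_graph M E nbr d"
    using graphing_is_borel_graph[OF assms(3)] by blast
  define d where "d = max b D"
  obtain nbr where G: "borel_graph M E nbr d" using b[of d] by (auto simp: d_def)
  have "sets M = sets borel" using assms(3) by (simp add: graphing_def)
  then obtain \<kappa> :: "'a \<Rightarrow> nat" where \<kappa>: "\<kappa> \<in> M \<rightarrow>\<^sub>M count_space UNIV"
      "\<And>x y. y \<in> ball_r E x 2 \<Longrightarrow> y \<noteq> x \<Longrightarrow> \<kappa> y \<noteq> \<kappa> x"
    using countable_distance_2_colouring[OF G] by blast
  define \<mu> where "\<mu> n = measure_pmf (pmf_of_set (Vs n))" for n
  define nb where "nb n i x = (if adj (Es n) x i then i else x)" for n and i x :: nat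
  have Gn: "borel_graph (\<mu> n) (Es n) (nb n) d" for n
    unfolding \<mu>_def nb_def by (rule finite_graph_is_borel_graph[OF assms(2)]) (simp add: d_def)
  \<comment> \<open>Depends on d and k only, so it is fixed before \<epsilon>, r and n.\<close>
  define K where "K = card (code_set ((d + 1)\<^sup>2) k)"
  have "(0, {}) \<in> code_set ((d + 1)\<^sup>2) k" by (simp add: code_set_def)
  then have "code_set ((d + 1)\<^sup>2) k \<noteq> {}" by blast
  then have "K \<ge> 1" by (simp add: K_def Suc_le_eq card_gt_0_iff finite_code_set)
  show "hausdorff_conv (dist_quot k)
           (\<lambda>n. quotients_fin (Es n) (\<lambda>F. graph_rank (Vs n) F / real (card (Vs n))) k)
           (quotients_gr M E (graphing_rank M) k)"
    unfolding hausdorff_conv_def quotients_fin_eq_quotients_gr[OF assms(2)] \<mu>_def[symmetric]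
  proof (intro allI impI)
    fix \<epsilon> :: real assume "\<epsilon> > 0"
    obtain r where r: "r > 0" "2 / real r < \<epsilon> / 2"
    proof -
      obtain m where "4 / \<epsilon> < real m" using reals_Archimedean2 by blast
      moreover have "0 < 4 / \<epsilon>" using \<open>\<epsilon> > 0\<close> by simp
      ultimately have "0 < real m" "4 < \<epsilon> * real m"
        using \<open>\<epsilon> > 0\<close> by (linarith, simp add: pos_divide_less_eq mult.commute)
      then show ?thesis using \<open>\<epsilon> > 0\<close> by (intro that[of m]) (auto simp: field_simps)
    qed
    define N where "N = real (card (bounded_reps ((d + 1) ^ r) K))"
    have "N \<ge> 0" by (simp add: N_def)
    \<comment> \<open>Gives the statistics at most \<epsilon>/2, the other half going to 2 / r; N +
      1 keeps the denominator positive.\<close>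
    define \<delta> where "\<delta> = \<epsilon> / (2 * (N + 1))"
    have "\<delta> > 0" using \<open>\<epsilon> > 0\<close> \<open>N \<ge> 0\<close> by (simp add: \<delta>_def)
    have "N * \<delta> \<le> \<epsilon> / 2" using \<open>\<epsilon> > 0\<close> \<open>N \<ge> 0\<close> by (simp add: \<delta>_def field_simps)
    then have small: "2 / real r + real (card (bounded_reps ((d + 1) ^ r) K)) * \<delta> < \<epsilon>"
      using r(2) by (simp add: N_def)
    have "hausdorff_conv dist_P (\<lambda>n. Q_fin (Vs n) (Es n) K r) (Q_gr M E K r)"
      using assms(4) \<open>K \<ge> 1\<close> r(1) by (simp add: local_global_conv_def Suc_le_eq)
    then have "\<forall>\<^sub>F n in sequentially.
       (\<forall>p\<in>Q_gr (\<mu> n) (Es n) K r. \<exists>q\<in>Q_gr M E K r. dist_P p q < \<delta>) \<and>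
       (\<forall>q\<in>Q_gr M E K r. \<exists>p\<in>Q_gr (\<mu> n) (Es n) K r. dist_P p q < \<delta>)"
      using \<open>\<delta> > 0\<close>
      unfolding hausdorff_conv_def Q_fin_eq_Q_gr[OF assms(2) \<open>K \<ge> 1\<close>] \<mu>_def[symmetric] by blast
    then show "\<forall>\<^sub>F n in sequentially.
       (\<forall>p\<in>quotients_gr (\<mu> n) (Es n) (graphing_rank (\<mu> n)) k.
          \<exists>q\<in>quotients_gr M E (graphing_rank M) k. dist_quot k p q < \<epsilon>) \<and>
       (\<forall>q\<in>quotients_gr M E (graphing_rank M) k.
          \<exists>p\<in>quotients_gr (\<mu> n) (Es n) (graphing_rank (\<mu> n)) k. dist_quot k p q < \<epsilon>)"
    proof (eventually_elim, intro conjI ballI)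
      fix n p
      assume H: "(\<forall>p\<in>Q_gr (\<mu> n) (Es n) K r. \<exists>q\<in>Q_gr M E K r. dist_P p q < \<delta>) \<and>
        (\<forall>q\<in>Q_gr M E K r. \<exists>p\<in>Q_gr (\<mu> n) (Es n) K r. dist_P p q < \<delta>)"
      show "\<exists>q\<in>quotients_gr M E (graphing_rank M) k. dist_quot k p q < \<epsilon>"
        if "p \<in> quotients_gr (\<mu> n) (Es n) (graphing_rank (\<mu> n)) k"
      proof (rule quotient_transfer[OF Gn G _ _ k r(1) K_def _ small that])
        \<comment> \<open>The vertices of the finite graphs are naturals, so the identity serves as
          distance-2 colouring.\<close>
        show "(\<lambda>x. x) \<in> \<mu> n \<rightarrow>\<^sub>M count_space UNIV" by (simp add: \<mu>_def)
      qed (use H in auto)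
      show "\<exists>q\<in>quotients_gr (\<mu> n) (Es n) (graphing_rank (\<mu> n)) k. dist_quot k q p < \<epsilon>"
        if "p \<in> quotients_gr M E (graphing_rank M) k"
      proof -
        have "\<exists>q\<in>quotients_gr (\<mu> n) (Es n) (graphing_rank (\<mu> n)) k. dist_quot k p q < \<epsilon>"
          by (rule quotient_transfer[OF G Gn \<kappa> k r(1) K_def _ small that])
             (use H dist_P_commute in auto)
        then show ?thesis by (simp add: dist_quot_commute)
      qed
    qed
  qed
qed

end
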